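(* Let $G\subset GL(V)$ be a finite complex reflection group on a finite-dimensional complex vector space $V$, let $\mathcal{H}$ be its reflection arrangement (the set of all reflecting hyperplanes of $G$ in $V$), with intersection lattice $L$, and let $x\in L$. Let $\mathcal{H}_{\ge x}=\{H\cap x : H\in\mathcal{H},\ H\not\supset x\}$ be the restricted hyperplane arrangement in the vector space $x$, with intersection lattice $L_{\ge x}=\{y\in L:y\ge x\}$. Then the relation complex of $\mathcal{H}_{\ge x}$ is $L_{\ge x}$-contractible. In other words, any restriction of a reflection arrangement is $L$-contractible.
   Context: A finite complex reflection group on $V$ is a finite subgroup of $GL(V)$ generated by complex reflections (elements fixing a hyperplane pointwise). Geometric lattices. All lattices are finite. A geometric lattice $L$ is an atomic semimodular lattice; it has a minimal element $0$ and a rank function $\mathrm{rk}$. Write $y\prec x$ if $x$ covers $y$, $L_i=\{x\in L:\mathrm{rk}(x)=i\}$, $\mathbb{A}(L)=L_1$ for the set of atoms, $L_{\le x}=\{y\in L:y\le x\}$. The intersection lattice of a finite set of hyperplanes (linear subspaces of codimension 1) in a vector space is the set of all intersections of its elements (including the empty intersection, i.e. the whole space, which is the minimal element), ordered by reverse inclusion; it is a geometric lattice with rank function the codimension, and its atoms are the hyperplanes. Compatible grading. Let $L$ be a geometric lattice of rank $n$ and $R$ a ring with $1$. A compatible $L$-grading on a chain complex $V_{n+1}=0\to V_n\to\dots\to V_i\xrightarrow{\partial_i}V_{i-1}\to\dots\to V_0$ of $R$-modules is given by submodules $V_x\subset V_{\mathrm{rk}(x)}$, $x\in L$, with $V_i=\bigoplus_{\mathrm{rk}(x)=i}V_x$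 for all $i$ and $\partial(V_x)\subset\bigoplus_{y\prec x}V_y$ for $x\ne0$. For $x\in L$, $V_{\le x}=\bigoplus_{y\le x}V_y$ is a subcomplex, compatibly graded by $L_{\le x}$. Minimal complex. An atomic datum $\mathcal{D}=(U_0,(U_a)_{a\in\mathbb{A}(L)})$ is an $R$-module $U_0$ with submodules $U_a$, one for each atom. Its minimal complex $\mathcal{O}(\mathcal{D},L)$ is the unique compatibly $L$-graded chain complex $V=\bigoplus_{x\in L}V_x$ such that $V_0=U_0$; $V_a=U_a$ for each atom $a$, with $\partial|_{V_a}$ the inclusion $U_a\hookrightarrow U_0$; and, for $\mathrm{rk}(x)=i>1$, $V_x=\mathrm{Ker}\big(\partial_{i-1}|_{\bigoplus_{y\prec x}V_y}\big)$ with $\partial|_{V_x}$ the inclusion $V_x\hookrightarrow\bigoplus_{y\prec x}V_y$. Relation complex. For a hyperplane arrangement $\mathcal{B}$ in a vector space $U^*$ (the dual of a finite-dimensional space $U$), with intersection lattice $L$, the relation complex of $\mathcal{B}$ is the minimal complex of the atomic datum $(U,(H^\perp)_{H\in\mathcal{B}})$, where $H^\perp=\{u\in U:\langle\lambda,u\rangle=0\ \forall\lambda\in H\}$. $L$-homotopy and $L$-contractibility. An $L$-homotopy for a compatibly $L$-graded complex $V$ is a sequence of morphisms $d_0:\mathrm{Im}\,\partial_1\to V_1$ and $d_i:V_i\to V_{i+1}$, $i=1,\dots,n$, with $d_{i-1}\partial_i+\partial_{i+1}d_i=\mathrm{id}_{V_i}$ for $i=1,\dots,n$ and $d_{\mathrm{rk}(x)}(V_x)\subset\bigoplus_{y\succ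 x}V_y$ for all $x\in L\setminus\{0\}$. $V$ is called $L$-contractible if for every $x\in L$ the $L_{\le x}$-graded complex $V_{\le x}$ admits an $L_{\le x}$-homotopy. *)

theory Defs
  imports Complex_Main "HOL-Library.Function_Algebras" "HOL-Algebra.Generated_Groups"
begin

section \<open>Finite posets\<close>

text \<open>The notions below are used for geometric lattices only, but make sense for every finite
  partially ordered set with a least element.  In a geometric lattice all maximal chains between
  two elements have the same length, so \<open>poset_rank L x\<close> is the usual rank, the number of steps
  in a maximal chain from the least element to \<open>x\<close>.\<close>

definition covers :: "('l, 'c) gorder_scheme \<Rightarrow> 'l \<Rightarrow> 'l \<Rightarrow> bool" where
  "covers L y x \<longleftrightarrow> x \<in> carrier L \<and> y \<in> carrier L \<and> y \<sqsubset>\<^bsub>L\<^esub> x \<and>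
     \<not> (\<exists>z \<in> carrier L. y \<sqsubset>\<^bsub>L\<^esub> z \<and> z \<sqsubset>\<^bsub>L\<^esub> x)"

definition poset_rank :: "('l, 'c) gorder_scheme \<Rightarrow> 'l \<Rightarrow> nat" where
  "poset_rank L x = Max {card K | K. K \<subseteq> {y \<in> carrier L. y \<sqsubset>\<^bsub>L\<^esub> x} \<and>
     (\<forall>y \<in> K. \<forall>z \<in> K. y \<sqsubseteq>\<^bsub>L\<^esub> z \<or> z \<sqsubseteq>\<^bsub>L\<^esub> y)}"

definition level :: "('l, 'c) gorder_scheme \<Rightarrow> nat \<Rightarrow> 'l set" where
  "level L i = {x \<in> carrier L. poset_rank L x = i}"

definition lower_interval :: "('l, 'c) gorder_scheme \<Rightarrow> 'l \<Rightarrow> ('l, 'c) gorder_scheme" where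
  "lower_interval L x = L\<lparr>carrier := {y \<in> carrier L. y \<sqsubseteq>\<^bsub>L\<^esub> x}\<rparr>"

definition upper_interval :: "('l, 'c) gorder_scheme \<Rightarrow> 'l \<Rightarrow> ('l, 'c) gorder_scheme" where
  "upper_interval L x = L\<lparr>carrier := {y \<in> carrier L. x \<sqsubseteq>\<^bsub>L\<^esub> y}\<rparr>"

section \<open>Graded complexes\<close>

text \<open>All modules of a complex are submodules of one ambient module, the type \<open>'m\<close> with the scalar
  multiplication \<open>scl\<close>.  The submodule of \<open>x\<close> is \<open>piece x\<close>, and \<open>bd i\<close> is the boundary map out of
  degree \<open>i\<close>; only its values on the degree \<open>i\<close> part (and only \<open>i \<ge> 1\<close>) are relevant.  The module in
  degree \<open>i\<close> is not a separate datum: it is the sum of the pieces of rank \<open>i\<close>, which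
  \<open>compatible_grading\<close> requires to be direct.\<close>

record ('r, 'l, 'm) graded_complex =
  scl :: "'r \<Rightarrow> 'm \<Rightarrow> 'm"
  piece :: "'l \<Rightarrow> 'm set"
  bd :: "nat \<Rightarrow> 'm \<Rightarrow> 'm"

definition internal_sum :: "('l \<Rightarrow> 'm::ab_group_add set) \<Rightarrow> 'l set \<Rightarrow> 'm set" where
  "internal_sum V I = {\<Sum>x\<in>I. f x | f. \<forall>x\<in>I. f x \<in> V x}"

definition independent_family :: "('l \<Rightarrow> 'm::ab_group_add set) \<Rightarrow> 'l set \<Rightarrow> bool" where
  "independent_family V I \<longleftrightarrow>
     (\<forall>f. (\<forall>x\<in>I. f x \<in> V x) \<and> (\<Sum>x\<in>I. f x) = 0 \<longrightarrow> (\<forall>x\<in>I. f x = 0))"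

definition hom_on ::
  "('r \<Rightarrow> 'm \<Rightarrow> 'm) \<Rightarrow> 'm::ab_group_add set \<Rightarrow> ('m \<Rightarrow> 'm) \<Rightarrow> bool" where
  "hom_on s S f \<longleftrightarrow> (\<forall>u\<in>S. \<forall>v\<in>S. f (u + v) = f u + f v) \<and> (\<forall>c. \<forall>u\<in>S. f (s c u) = s c (f u))"

definition degree_part ::
  "('l, 'c) gorder_scheme \<Rightarrow> ('r, 'l, 'm::ab_group_add) graded_complex \<Rightarrow> nat \<Rightarrow> 'm set" where
  "degree_part L C i = internal_sum (piece C) (level L i)"

definition compatible_grading ::
  "('l, 'c) gorder_scheme \<Rightarrow> ('r::comm_ring_1, 'l, 'm::ab_group_add) graded_complex \<Rightarrow> bool" where
  "compatible_grading L C \<longleftrightarrow>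
     module (scl C) \<and>
     (\<forall>x \<in> carrier L. module.subspace (scl C) (piece C x)) \<and>
     (\<forall>i. independent_family (piece C) (level L i)) \<and>
     (\<forall>i\<ge>1. hom_on (scl C) (degree_part L C i) (bd C i) \<and>
             bd C i ` degree_part L C i \<subseteq> degree_part L C (i - 1)) \<and>
     (\<forall>i\<ge>1. \<forall>v \<in> degree_part L C (Suc i). bd C i (bd C (Suc i) v) = 0) \<and>
     (\<forall>x \<in> carrier L. poset_rank L x > 0 \<longrightarrow>
        bd C (poset_rank L x) ` piece C x \<subseteq> internal_sum (piece C) {y. covers L y x})"

text \<open>The subcomplex of \<open>C\<close> on the elements below \<open>x\<close> has the same pieces and boundary maps as \<open>C\<close>;
  it is \<open>C\<close> regarded as a complex over \<open>lower_interval L x\<close>.\<close>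

definition is_homotopy ::
  "('l, 'c) gorder_scheme \<Rightarrow> ('r, 'l, 'm::ab_group_add) graded_complex \<Rightarrow> (nat \<Rightarrow> 'm \<Rightarrow> 'm) \<Rightarrow> bool"
  where
  "is_homotopy L C d \<longleftrightarrow>
    (let n = Max (poset_rank L ` carrier L) in
     hom_on (scl C) (bd C 1 ` degree_part L C 1) (d 0) \<and>
     d 0 ` bd C 1 ` degree_part L C 1 \<subseteq> degree_part L C 1 \<and>
     (\<forall>i \<in> {1..n}. hom_on (scl C) (degree_part L C i) (d i) \<and>
                    d i ` degree_part L C i \<subseteq> degree_part L C (Suc i)) \<and>
     (\<forall>i \<in> {1..n}. \<forall>v \<in> degree_part L C i. d (i - 1) (bd C i v) + bd C (Suc i) (d i v) = v) \<and>
     (\<forall>x \<in> carrier L. poset_rank L x > 0 \<longrightarrow>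
        d (poset_rank L x) ` piece C x \<subseteq> internal_sum (piece C) {y. covers L x y}))"

definition contractible_over ::
  "('l, 'c) gorder_scheme \<Rightarrow> ('r::comm_ring_1, 'l, 'm::ab_group_add) graded_complex \<Rightarrow> bool" where
  "contractible_over L C \<longleftrightarrow> compatible_grading L C \<and>
     (\<forall>x \<in> carrier L. \<exists>d. is_homotopy (lower_interval L x) C d)"

section \<open>Minimal complexes\<close>

text \<open>The piece of \<open>x\<close> is a copy, indexed by \<open>x\<close>, of a submodule of the sum of the pieces of the
  elements covered by \<open>x\<close>.  Unfolding this, a chain is a function from lists
  \<open>[x\<^sub>i, \<dots>, x\<^sub>1]\<close> of lattice elements of ranks \<open>i, \<dots>, 1\<close> to the module \<open>U\<^sub>0\<close>; chains in degree \<open>0\<close> are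
  supported at the empty list.  The map \<open>copy_at x\<close> sends a chain to its copy indexed by \<open>x\<close>, and
  \<open>strip L\<close>, which satisfies \<open>strip L (copy_at x g) = g\<close>, forgets the index.  So \<open>strip L\<close> is
  the boundary map given on each piece by the inclusion.\<close>

definition fun_scale :: "('r \<Rightarrow> 'u \<Rightarrow> 'u) \<Rightarrow> 'r \<Rightarrow> ('k \<Rightarrow> 'u) \<Rightarrow> 'k \<Rightarrow> 'u" where
  "fun_scale s c f = (\<lambda>k. s c (f k))"

definition base :: "'u::zero \<Rightarrow> 'l list \<Rightarrow> 'u" where
  "base u = (\<lambda>c. if c = [] then u else 0)"

definition copy_at :: "'l \<Rightarrow> ('l list \<Rightarrow> 'u::zero) \<Rightarrow> 'l list \<Rightarrow> 'u" where
  "copy_at x g = (\<lambda>c. case c of [] \<Rightarrow> 0 | y # c' \<Rightarrow> if y = x then g c' else 0)"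

definition strip ::
  "('l, 'c) gorder_scheme \<Rightarrow> ('l list \<Rightarrow> 'u::ab_group_add) \<Rightarrow> 'l list \<Rightarrow> 'u" where
  "strip L g = (\<lambda>c. \<Sum>x \<in> carrier L. g (x # c))"

text \<open>\<open>minimal_piece L U0 U i x\<close> is the piece of an element \<open>x\<close> of rank \<open>i\<close>.\<close>

primrec minimal_piece ::
  "('l, 'c) gorder_scheme \<Rightarrow> 'u::ab_group_add set \<Rightarrow> ('l \<Rightarrow> 'u set) \<Rightarrow> nat \<Rightarrow> 'l \<Rightarrow> ('l list \<Rightarrow> 'u) set"
  where
  "minimal_piece L U0 U 0 x = base ` U0"
| "minimal_piece L U0 U (Suc i) x = copy_at x `
     (if i = 0 then base ` U x
      else {g \<in> internal_sum (minimal_piece L U0 U i) {y. covers L y x}. strip L g = 0})"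

definition minimal_complex ::
  "('r \<Rightarrow> 'u \<Rightarrow> 'u) \<Rightarrow> ('l, 'c) gorder_scheme \<Rightarrow> 'u::ab_group_add set \<Rightarrow> ('l \<Rightarrow> 'u set) \<Rightarrow>
    ('r, 'l, 'l list \<Rightarrow> 'u) graded_complex" where
  "minimal_complex s L U0 U =
    \<lparr>scl = fun_scale s, piece = (\<lambda>x. minimal_piece L U0 U (poset_rank L x) x), bd = (\<lambda>i. strip L)\<rparr>"

section \<open>Arrangements and relation complexes\<close>

text \<open>Arrangements live in a subspace \<open>E\<close> of the vector space \<open>'v\<close>.\<close>

definition hyperplane_of ::
  "('k::field \<Rightarrow> 'v::ab_group_add \<Rightarrow> 'v) \<Rightarrow> 'v set \<Rightarrow> 'v set \<Rightarrow> bool" where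
  "hyperplane_of s E H \<longleftrightarrow>
     module.subspace s H \<and> H \<subseteq> E \<and> vector_space.dim s E = Suc (vector_space.dim s H)"

definition intersection_lattice :: "'v set \<Rightarrow> 'v set set \<Rightarrow> 'v set gorder" where
  "intersection_lattice E \<B> =
    \<lparr>carrier = {E \<inter> \<Inter>\<S> | \<S>. \<S> \<subseteq> \<B>}, eq = (=), le = (\<lambda>y z. z \<subseteq> y)\<rparr>"

definition restriction :: "'v set set \<Rightarrow> 'v set \<Rightarrow> 'v set set" where
  "restriction \<H> x = {H \<inter> x | H. H \<in> \<H> \<and> \<not> x \<subseteq> H}"

text \<open>A linear functional on \<open>E\<close> is represented by its extension by \<open>0\<close> to all of \<open>'v\<close> (which is not
  linear on \<open>'v\<close> in general).\<close>

definition dual_space :: "('k::field \<Rightarrow> 'v::ab_group_add \<Rightarrow> 'v) \<Rightarrow> 'v set \<Rightarrow> ('v \<Rightarrow> 'k) set" where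
  "dual_space s E = {\<phi>. (\<forall>v\<in>E. \<forall>w\<in>E. \<phi> (v + w) = \<phi> v + \<phi> w) \<and>
     (\<forall>c. \<forall>v\<in>E. \<phi> (s c v) = c * \<phi> v) \<and> (\<forall>v. v \<notin> E \<longrightarrow> \<phi> v = 0)}"

definition annihilator ::
  "('k::field \<Rightarrow> 'v::ab_group_add \<Rightarrow> 'v) \<Rightarrow> 'v set \<Rightarrow> 'v set \<Rightarrow> ('v \<Rightarrow> 'k) set" where
  "annihilator s E H = {\<phi> \<in> dual_space s E. \<forall>v\<in>H. \<phi> v = 0}"

text \<open>The relation complex of an arrangement in \<open>U\<^sup>*\<close> has \<open>U\<close> in degree \<open>0\<close>.  Here \<open>U\<^sup>* = E\<close>, and the
  finite-dimensional space \<open>U\<close> is the dual of \<open>E\<close>.\<close>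

definition relation_complex ::
  "('k::field \<Rightarrow> 'v::ab_group_add \<Rightarrow> 'v) \<Rightarrow> 'v set \<Rightarrow> 'v set set \<Rightarrow>
    ('k, 'v set, 'v set list \<Rightarrow> 'v \<Rightarrow> 'k) graded_complex" where
  "relation_complex s E \<B> = minimal_complex (fun_scale (*)) (intersection_lattice E \<B>)
     (dual_space s E) (annihilator s E)"

section \<open>Complex reflection groups\<close>

definition GL :: "('k::field \<Rightarrow> 'v::ab_group_add \<Rightarrow> 'v) \<Rightarrow> ('v \<Rightarrow> 'v) monoid" where
  "GL s = \<lparr>carrier = {g. Vector_Spaces.linear s s g \<and> bij g}, monoid.mult = (\<circ>), one = id\<rparr>"

text \<open>The identity fixes every hyperplane pointwise, so it has to be excluded: otherwise every
  hyperplane would be a reflecting hyperplane.\<close>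

definition reflection_in ::
  "('k::field \<Rightarrow> 'v::ab_group_add \<Rightarrow> 'v) \<Rightarrow> 'v set \<Rightarrow> ('v \<Rightarrow> 'v) \<Rightarrow> bool" where
  "reflection_in s H g \<longleftrightarrow>
     g \<in> carrier (GL s) \<and> g \<noteq> id \<and> hyperplane_of s UNIV H \<and> (\<forall>v\<in>H. g v = v)"

definition finite_reflection_group ::
  "('k::field \<Rightarrow> 'v::ab_group_add \<Rightarrow> 'v) \<Rightarrow> ('v \<Rightarrow> 'v) set \<Rightarrow> bool" where
  "finite_reflection_group s G \<longleftrightarrow> subgroup G (GL s) \<and> finite G \<and>
     (\<exists>R. (\<forall>g\<in>R. \<exists>H. reflection_in s H g) \<and> G = generate (GL s) R)"

definition reflection_arrangement ::
  "('k::field \<Rightarrow> 'v::ab_group_add \<Rightarrow> 'v) \<Rightarrow> ('v \<Rightarrow> 'v) set \<Rightarrow> 'v set set" where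
  "reflection_arrangement s G = {H. \<exists>g\<in>G. reflection_in s H g}"

section \<open>Consistency of the definitions\<close>

lemma module_fun_scale:
  assumes "module s"
  shows "module (fun_scale s)"
proof -
  interpret module s by fact
  show ?thesis
    by unfold_locales (auto simp: fun_scale_def plus_fun_def algebra_simps)
qed

lemma intersection_lattice_restriction:
  assumes "x \<in> carrier (intersection_lattice UNIV \<H>)"
  shows "intersection_lattice x (restriction \<H> x) =
    upper_interval (intersection_lattice UNIV \<H>) x"
proof -
  from assms obtain \<T> where T: "\<T> \<subseteq> \<H>" "x = \<Inter>\<T>"
    by (auto simp: intersection_lattice_def)
  have "{x \<inter> \<Inter>\<S> | \<S>. \<S> \<subseteq> restriction \<H> x} = {y. (\<exists>\<S>\<subseteq>\<H>. y = \<Inter>\<S>) \<and> y \<subseteq> x}" (is "?A = ?B")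
  proof (intro equalityI subsetI)
    fix y assume "y \<in> ?A"
    then obtain \<S> where S: "\<S> \<subseteq> restriction \<H> x" "y = x \<inter> \<Inter>\<S>" by auto
    let ?S = "\<T> \<union> {H \<in> \<H>. H \<inter> x \<in> \<S>}"
    have "y = \<Inter>?S"
    proof (intro equalityI subsetI)
      fix v assume v: "v \<in> y"
      have "v \<in> H" if "H \<in> ?S" for H
        using that v S(2) T(2) by blast
      then show "v \<in> \<Inter>?S" by blast
    next
      fix v assume v: "v \<in> \<Inter>?S"
      then have x: "v \<in> x" unfolding T(2) by blast
      have "v \<in> A" if A: "A \<in> \<S>" for A
      proof -
        obtain H where "H \<in> \<H>" "A = H \<inter> x"
          using A S(1) by (auto simp: restriction_def)
        with A v x show ?thesis by blast
      qed
      with x show "v \<in> y" unfolding S(2) by blast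
    qed
    moreover have "?S \<subseteq> \<H>" "y \<subseteq> x" using T(1) S(2) by auto
    ultimately show "y \<in> ?B" by (intro CollectI conjI exI[of _ ?S])
  next
    fix y assume "y \<in> ?B"
    then obtain \<S> where S: "\<S> \<subseteq> \<H>" "y = \<Inter>\<S>" "y \<subseteq> x" by auto
    let ?S = "{H \<inter> x | H. H \<in> \<S> \<and> \<not> x \<subseteq> H}"
    have "y = x \<inter> \<Inter>?S"
    proof (intro equalityI subsetI)
      fix v assume "v \<in> y"
      with S(2,3) show "v \<in> x \<inter> \<Inter>?S" by auto
    next
      fix v assume v: "v \<in> x \<inter> \<Inter>?S"
      have "v \<in> H" if "H \<in> \<S>" for H
        using that v by (cases "x \<subseteq> H") auto
      then show "v \<in> y" unfolding S(2) by blast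
    qed
    moreover have "?S \<subseteq> restriction \<H> x" using S(1) by (auto simp: restriction_def)
    ultimately show "y \<in> ?A" by (intro CollectI conjI exI[of _ ?S])
  qed
  then show ?thesis
    by (auto simp: intersection_lattice_def upper_interval_def)
qed

lemma strip_copy_at:
  assumes "finite (carrier L)" "x \<in> carrier L"
  shows "strip L (copy_at x g) = g"
  using assms by (auto simp: strip_def copy_at_def fun_eq_iff)

lemma strip_base: "strip L (base u) = 0"
  by (auto simp: strip_def base_def fun_eq_iff)

lemma strip_add: "strip L (f + g) = strip L f + strip L g"
  by (auto simp: strip_def fun_eq_iff sum.distrib)

lemma strip_scale:
  assumes "module s"
  shows "strip L (fun_scale s c f) = fun_scale s c (strip L f)"
proof -
  interpret module s by fact
  show ?thesis by (auto simp: strip_def fun_scale_def scale_sum_right fun_eq_iff)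
qed

lemma strip_sum: "strip L (sum f I) = (\<Sum>i\<in>I. strip L (f i))"
proof (induction I rule: infinite_finite_induct)
  case (insert i I)
  then show ?case by (simp only: sum.insert[OF insert.hyps] strip_add)
qed (auto simp: strip_def fun_eq_iff)

lemma subspace_internal_sum:
  assumes m: "module s" and V: "\<And>x. x \<in> I \<Longrightarrow> module.subspace s (V x)"
  shows "module.subspace s (internal_sum V I)"
proof -
  interpret module s by fact
  show ?thesis
  proof (rule subspaceI)
    show "0 \<in> internal_sum V I"
      unfolding internal_sum_def using V subspace_0
      by (intro CollectI exI[of _ "\<lambda>_. 0"]) auto
  next
    fix u v assume "u \<in> internal_sum V I" "v \<in> internal_sum V I"
    then obtain f g where "\<forall>x\<in>I. f x \<in> V x" "u = sum f I" "\<forall>x\<in>I. g x \<in> V x" "v = sum g I"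
      by (auto simp: internal_sum_def)
    then show "u + v \<in> internal_sum V I"
      unfolding internal_sum_def using V subspace_add
      by (intro CollectI exI[of _ "\<lambda>x. f x + g x"]) (auto simp: sum.distrib)
  next
    fix c u assume "u \<in> internal_sum V I"
    then obtain f where "\<forall>x\<in>I. f x \<in> V x" "u = sum f I"
      by (auto simp: internal_sum_def)
    then show "s c u \<in> internal_sum V I"
      unfolding internal_sum_def using V subspace_scale
      by (intro CollectI exI[of _ "\<lambda>x. s c (f x)"]) (auto simp: scale_sum_right)
  qed
qed

lemma internal_sum_mono:
  assumes "module s" "finite J" "I \<subseteq> J" "\<And>x. x \<in> J \<Longrightarrow> module.subspace s (V x)"
  shows "internal_sum V I \<subseteq> internal_sum V J"
proof
  interpret module s by fact
  fix u assume "u \<in> internal_sum V I"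
  then obtain f where f: "\<forall>x\<in>I. f x \<in> V x" "u = sum f I"
    by (auto simp: internal_sum_def)
  let ?f = "\<lambda>x. if x \<in> I then f x else 0"
  have "u = sum ?f J"
    using f(2) assms(2,3) by (simp add: sum.inter_restrict[symmetric] Int_absorb1)
  moreover have "\<forall>x\<in>J. ?f x \<in> V x" using f(1) assms(4) subspace_0 by auto
  ultimately show "u \<in> internal_sum V J" unfolding internal_sum_def by blast
qed

lemma subspace_copy_at:
  fixes s :: "'r::comm_ring_1 \<Rightarrow> 'u::ab_group_add \<Rightarrow> 'u"
  assumes m: "module s" and S: "module.subspace (fun_scale s) (S :: ('l list \<Rightarrow> 'u) set)"
  shows "module.subspace (fun_scale s) (copy_at x ` S)"
proof -
  interpret s: module s by fact
  interpret module "fun_scale s" using m by (rule module_fun_scale)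
  have [simp]: "copy_at x (0 :: 'l list \<Rightarrow> 'u) = 0"
    and add: "\<And>g h :: 'l list \<Rightarrow> 'u. copy_at x g + copy_at x h = copy_at x (g + h)"
    and scl: "\<And>c (g :: 'l list \<Rightarrow> 'u). fun_scale s c (copy_at x g) = copy_at x (fun_scale s c g)"
    by (auto simp: copy_at_def fun_eq_iff fun_scale_def split: list.splits)
  show ?thesis
  proof (rule subspaceI)
    show "0 \<in> copy_at x ` S"
      using imageI[OF subspace_0[OF S], of "copy_at x"] by simp
  qed (use S in \<open>auto simp: add scl intro!: imageI subspace_add[OF S] subspace_scale[OF S]\<close>)
qed

lemma subspace_base:
  fixes s :: "'r::comm_ring_1 \<Rightarrow> 'u::ab_group_add \<Rightarrow> 'u"
  assumes m: "module s" and S: "module.subspace s S"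
  shows "module.subspace (fun_scale s) (base ` S :: ('l list \<Rightarrow> 'u) set)"
proof -
  interpret s: module s by fact
  interpret module "fun_scale s" using m by (rule module_fun_scale)
  have z: "base (0::'u) = (0 :: 'l list \<Rightarrow> 'u)"
    and add: "\<And>g h :: 'u. base g + base h = (base (g + h) :: 'l list \<Rightarrow> 'u)"
    and scl: "\<And>c g. fun_scale s c (base g) = (base (s c g) :: 'l list \<Rightarrow> 'u)"
    by (auto simp: base_def fun_eq_iff fun_scale_def)
  show ?thesis
  proof (rule subspaceI)
    show "0 \<in> (base ` S :: ('l list \<Rightarrow> 'u) set)" using s.subspace_0[OF S] by (intro image_eqI[where x = 0]) (simp_all add: z)
  qed (use S in \<open>auto simp: add scl intro!: imageI s.subspace_add[OF S] s.subspace_scale[OF S]\<close>)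
qed

text \<open>Over a finite graded poset with least element \<open>b\<close>, the minimal complex is compatibly graded and
  satisfies the defining conditions of the minimal complex.\<close>

context
  fixes s :: "'r::comm_ring_1 \<Rightarrow> 'u::ab_group_add \<Rightarrow> 'u"
    and L :: "('l, 'c) gorder_scheme" and U0 :: "'u set" and U :: "'l \<Rightarrow> 'u set" and b :: 'l
  assumes m: "module s" and fin: "finite (carrier L)"
    and graded: "\<And>y x. covers L y x \<Longrightarrow> poset_rank L x = Suc (poset_rank L y)"
    and bot: "level L 0 = {b}" and atoms: "\<And>a. a \<in> level L 1 \<Longrightarrow> covers L b a"
    and U0: "module.subspace s U0"
    and U: "\<And>a. a \<in> level L 1 \<Longrightarrow> module.subspace s (U a)" "\<And>a. a \<in> level L 1 \<Longrightarrow> U a \<subseteq> U0"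
begin

interpretation F: module "fun_scale s" by (rule module_fun_scale[OF m])

abbreviation "C \<equiv> minimal_complex s L U0 U"

lemma piece_rank_0: "piece C b = base ` U0"
proof -
  have "poset_rank L b = 0" using bot by (auto simp: level_def)
  then show ?thesis by (simp add: minimal_complex_def)
qed

lemma piece_rank_1: "a \<in> level L 1 \<Longrightarrow> bij_betw (strip L) (piece C a) (base ` U a)"
  by (rule bij_betw_byWitness[where f' = "copy_at a"])
    (auto simp: minimal_complex_def level_def strip_copy_at fin)

lemma covers_level: "x \<in> level L (Suc i) \<Longrightarrow> {y. covers L y x} \<subseteq> level L i"
  using graded by (fastforce simp: level_def covers_def)

lemma piece_eq:
  assumes "x \<in> level L (Suc (Suc i))"
  shows "piece C x = copy_at x ` {g \<in> internal_sum (piece C) {y. covers L y x}. strip L g = 0}"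
proof -
  have "internal_sum (piece C) {y. covers L y x}
      = internal_sum (minimal_piece L U0 U (Suc i)) {y. covers L y x}"
    using covers_level[OF assms] unfolding internal_sum_def
    by (intro Collect_cong ex_cong conj_cong refl ball_cong)
      (auto simp: minimal_complex_def level_def)
  then show ?thesis using assms by (simp add: minimal_complex_def level_def)
qed

lemma piece_rank_ge_2:
  assumes "x \<in> level L (Suc (Suc i))"
  shows "bij_betw (strip L) (piece C x)
    {g \<in> internal_sum (piece C) {y. covers L y x}. strip L g = 0}"
  unfolding piece_eq[OF assms] using assms
  by (intro bij_betw_byWitness[where f' = "copy_at x"])
    (auto simp: level_def strip_copy_at fin)

lemma subspace_piece: "x \<in> level L i \<Longrightarrow> module.subspace (fun_scale s) (piece C x)"
proof (induction i arbitrary: x)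
  case 0
  then show ?case using bot piece_rank_0 subspace_base[OF m U0] by auto
next
  case (Suc i)
  show ?case
  proof (cases i)
    case 0
    then have "piece C x = copy_at x ` base ` U x"
      using Suc.prems by (auto simp: minimal_complex_def level_def)
    then show ?thesis
      using Suc.prems 0 U(1)[of x] by (simp add: subspace_copy_at subspace_base m)
  next
    case (Suc j)
    have "module.subspace (fun_scale s) (internal_sum (piece C) {y. covers L y x})"
      using Suc.IH covers_level[OF Suc.prems]
      by (intro subspace_internal_sum[OF module_fun_scale[OF m]]) auto
    then have "module.subspace (fun_scale s)
        {g \<in> internal_sum (piece C) {y. covers L y x}. strip L g = 0}"
      by (auto simp: F.subspace_def strip_add strip_scale[OF m])
        (auto simp: strip_def zero_fun_def)
    then show ?thesis
      using Suc.prems Suc by (simp add: piece_eq subspace_copy_at m)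
  qed
qed

lemma minimal_complex_compatible: "compatible_grading L C"
proof -
  note mF = module_fun_scale[OF m]
  have fin_level: "finite (level L i)" for i
    using fin by (auto simp: level_def)
  have [simp]: "scl C = fun_scale s" "bd C i = strip L" for i
    by (auto simp: minimal_complex_def)
  have cov_b: "b \<in> {y. covers L y a}" "{y. covers L y a} \<subseteq> {b}" if "a \<in> level L 1" for a
    using atoms[OF that] covers_level[of a 0] bot that by auto
  have strip_piece: "strip L ` piece C x \<subseteq> internal_sum (piece C) {y. covers L y x}"
    if "x \<in> level L (Suc i)" for x i
  proof (cases i)
    case 0
    then have x: "x \<in> level L 1" using that by simp
    have "{y. covers L y x} = {b}" using cov_b[OF x] by auto
    then have "internal_sum (piece C) {y. covers L y x} = piece C b"
      unfolding internal_sum_def by auto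
    moreover have "strip L ` piece C x = base ` U x"
      using piece_rank_1[OF x] by (simp add: bij_betw_def)
    ultimately show ?thesis using U(2)[OF x] by (auto simp: piece_rank_0)
  next
    case (Suc j)
    then show ?thesis
      using piece_rank_ge_2[of x j] that by (auto simp: bij_betw_def)
  qed
  have strip_part: "strip L v \<in> degree_part L C i" if "v \<in> degree_part L C (Suc i)" for v i
  proof -
    from that obtain f where f: "\<forall>x\<in>level L (Suc i). f x \<in> piece C x" "v = sum f (level L (Suc i))"
      by (auto simp: degree_part_def internal_sum_def)
    have "strip L (f x) \<in> degree_part L C i" if "x \<in> level L (Suc i)" for x
    proof -
      have "strip L (f x) \<in> internal_sum (piece C) {y. covers L y x}"
        using strip_piece[OF that] f(1) that by auto
      then show ?thesis
        using internal_sum_mono[OF mF fin_level covers_level[OF that] subspace_piece]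
        unfolding degree_part_def by (rule rev_subsetD)
    qed
    moreover have "module.subspace (fun_scale s) (degree_part L C i)"
      unfolding degree_part_def by (intro subspace_internal_sum[OF mF] subspace_piece)
    ultimately show ?thesis
      unfolding f(2) strip_sum by (intro F.subspace_sum)
  qed
  have strip_strip: "strip L (strip L v) = 0" if "v \<in> degree_part L C (Suc (Suc i))" for v i
  proof -
    from that obtain f where f: "\<forall>x\<in>level L (Suc (Suc i)). f x \<in> piece C x"
        "v = sum f (level L (Suc (Suc i)))"
      by (auto simp: degree_part_def internal_sum_def)
    have "strip L (strip L (f x)) = 0" if "x \<in> level L (Suc (Suc i))" for x
      using piece_rank_ge_2[OF that] f(1) that by (auto simp: bij_betw_def)
    then show ?thesis unfolding f(2) strip_sum by (simp add: sum.neutral)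
  qed
  have indep: "independent_family (piece C) (level L i)" for i
  proof (cases i)
    case 0
    then show ?thesis using bot by (simp add: independent_family_def)
  next
    case (Suc j)
    have supp: "g [] = 0" "y \<noteq> x \<Longrightarrow> g (y # c) = 0"
      if "g \<in> piece C x" "x \<in> level L i" for g x y c
      using that Suc by (auto simp: minimal_complex_def level_def copy_at_def split: if_splits)
    have "f x = 0"
      if f: "\<forall>x\<in>level L i. f x \<in> piece C x" "sum f (level L i) = 0" and x: "x \<in> level L i" for f x
    proof
      fix c
      have app: "(\<Sum>z\<in>I. f z) c = (\<Sum>z\<in>I. f z c)" for I
        by (induction I rule: infinite_finite_induct) auto
      show "f x c = 0 c"
      proof (cases c)
        case Nil
        then show ?thesis using supp(1) f(1) x by auto
      next
        case (Cons y c')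
        show ?thesis
        proof (cases "y = x")
          case True
          have "(\<Sum>z\<in>level L i. f z c) = (\<Sum>z\<in>level L i. if z = x then f x c else 0)"
            using supp(2) f(1) Cons True by (intro sum.cong) auto
          also have "\<dots> = f x c" using x fin_level by simp
          finally show ?thesis using app f(2) by (metis zero_fun_apply)
        next
          case False
          then show ?thesis using supp(2) f(1) x Cons by auto
        qed
      qed
    qed
    then show ?thesis unfolding independent_family_def by blast
  qed
  show ?thesis
    unfolding compatible_grading_def
  proof (intro conjI ballI allI impI)
    fix x assume x: "x \<in> carrier L"
    then show "module.subspace (scl C) (piece C x)"
      using subspace_piece[of x "poset_rank L x"] by (simp add: level_def)
    assume "poset_rank L x > 0"
    then show "bd C (poset_rank L x) ` piece C x \<subseteq> internal_sum (piece C) {y. covers L y x}"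
      using strip_piece[of x "poset_rank L x - 1"] x by (simp add: level_def)
  next
    fix i :: nat assume i: "1 \<le> i"
    show "hom_on (scl C) (degree_part L C i) (bd C i)"
      by (simp add: hom_on_def strip_add strip_scale[OF m])
    show "bd C i ` degree_part L C i \<subseteq> degree_part L C (i - 1)"
      using strip_part[of _ "i - 1"] i by auto
    fix v assume "v \<in> degree_part L C (Suc i)"
    then show "bd C i (bd C (Suc i) v) = 0"
      using strip_strip[of v "i - 1"] i by simp
  qed (use mF indep in auto)
qed

end

end

theory Submission
  imports Defs
begin

text \<open>
  Let \<open>E\<close> be the restricted space.  For a lattice element \<open>z \<subseteq> E\<close> let \<open>N\<^sub>z\<close> be the sum of \<open>1 - g\<close> over
  the reflections \<open>g \<in> G\<close> that fix \<open>z\<close> pointwise.  It commutes with each of these reflections, so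
  it preserves every lattice element containing \<open>z\<close>.  A reflection that does not fix \<open>E\<close> pointwise
  fixes pointwise at most one hyperplane of \<open>E\<close>, so on \<open>E\<close> the operator \<open>N\<^sub>z\<close> is the sum of the \<open>N\<^sub>a\<close>
  over the restricted hyperplanes \<open>a \<supseteq> z\<close>.  The transpose \<open>f\<^sub>a\<close> of \<open>N\<^sub>a\<close> maps the dual of \<open>E\<close> to the
  line \<open>U\<^sub>a\<close> of functionals vanishing on \<open>a\<close>, so the transpose \<open>\<Delta>\<^sub>z\<close> of \<open>N\<^sub>z\<close> is the sum of the \<open>f\<^sub>a\<close>, \<open>a \<le> z\<close>
  (in the lattice order), and preserves each \<open>U\<^sub>a\<close>, \<open>a \<le> z\<close>.  Hence it acts on all pieces \<open>V\<^sub>x\<close>, \<open>x \<le> z\<close>,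
  of the relation complex.

  For any such family \<open>f\<^sub>a\<close> there are maps \<open>d\<close> with \<open>d\<partial> + \<partial>d = \<Delta>\<^sub>z\<close> on every subcomplex \<open>V\<^bsub>\<le> z\<^esub>\<close>,
  where \<open>d\<close> is truncated to \<open>V\<^bsub>\<le> z\<^esub>\<close>.  For \<open>v \<in> V\<^sub>x\<close> and \<open>y\<close> covering \<open>x\<close>, the component of \<open>d v\<close> at \<open>y\<close>
  is the element with boundary \<open>\<Delta>\<^sub>y v - d\<^sub>y \<partial>v\<close>, where \<open>d\<^sub>y\<close> is the part of \<open>d\<close> below \<open>y\<close>; by
  semimodularity these boundaries add up correctly.

  Composing with the inverse of \<open>\<Delta>\<^sub>z\<close> gives the homotopy.  The inverse exists because, by positivity
  of a \<open>G\<close>-invariant hermitian form, the kernel of \<open>N\<^sub>z\<close> is \<open>z\<close>; adding to \<open>N\<^sub>z\<close> the sum over the pointwise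
  stabiliser of \<open>z\<close>, which maps onto \<open>z\<close> and kills the image of \<open>N\<^sub>z\<close>, yields an injective operator.
\<close>

section \<open>Homotopies on minimal complexes\<close>

lemma internal_sum_induct [consumes 1, case_names zero add piece]:
  assumes "u \<in> internal_sum V I" and "Q 0" and "\<And>u v. Q u \<Longrightarrow> Q v \<Longrightarrow> Q (u + v)"
    and "\<And>x u. x \<in> I \<Longrightarrow> u \<in> V x \<Longrightarrow> Q u"
  shows "Q u"
proof -
  obtain g where g: "\<forall>x\<in>I. g x \<in> V x" "u = sum g I"
    using assms(1) by (auto simp: internal_sum_def)
  have "J \<subseteq> I \<Longrightarrow> Q (sum g J)" for J
    by (induction J rule: infinite_finite_induct) (use assms g(1) in auto)
  then show ?thesis using g(2) by blast
qed

lemma internal_sum_piece: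
  assumes "module s" "\<And>x. x \<in> I \<Longrightarrow> module.subspace s (V x)" "finite I" "x \<in> I" "u \<in> V x"
  shows "u \<in> internal_sum V I"
proof -
  have "u \<in> internal_sum V {x}"
    using assms(5) unfolding internal_sum_def by (intro CollectI exI[of _ "\<lambda>_. u"]) auto
  then show ?thesis using internal_sum_mono[of s I "{x}" V] assms by auto
qed

text \<open>A largest chain strictly below \<open>x\<close> remains a chain strictly below
  \<open>y\<close> when \<open>x\<close> is added to it.\<close>

lemma lless_imp_poset_rank_less:
  assumes "partial_order L" "finite (carrier L)" "x \<in> carrier L" "y \<in> carrier L" "x \<sqsubset>\<^bsub>L\<^esub> y"
  shows "poset_rank L x < poset_rank L y"
proof -
  interpret partial_order L by fact
  define chains where "chains x = {K. K \<subseteq> {y \<in> carrier L. y \<sqsubset>\<^bsub>L\<^esub> x} \<and>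
     (\<forall>y \<in> K. \<forall>z \<in> K. y \<sqsubseteq>\<^bsub>L\<^esub> z \<or> z \<sqsubseteq>\<^bsub>L\<^esub> y)}" for x
  have fin: "finite (chains x)" for x
    by (rule finite_subset[of _ "Pow (carrier L)"]) (use assms(2) in \<open>auto simp: chains_def\<close>)
  have rank: "poset_rank L x = Max (card ` chains x)" for x
    unfolding poset_rank_def chains_def by (rule arg_cong[where f = Max]) auto
  have ne: "chains x \<noteq> {}" for x by (auto simp: chains_def intro: exI[of _ "{}"])
  have "Max (card ` chains x) \<in> card ` chains x" using fin ne by (intro Max_in) auto
  then obtain K where K: "K \<in> chains x" "card K = poset_rank L x" by (auto simp: rank)
  have K': "K \<subseteq> carrier L" "\<And>z. z \<in> K \<Longrightarrow> z \<sqsubset>\<^bsub>L\<^esub> x"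
    "\<And>y z. y \<in> K \<Longrightarrow> z \<in> K \<Longrightarrow> y \<sqsubseteq>\<^bsub>L\<^esub> z \<or> z \<sqsubseteq>\<^bsub>L\<^esub> y"
    using K(1) by (auto simp: chains_def)
  have "x \<notin> K" using K'(2) by (auto simp: lless_eq)
  have "z \<in> carrier L \<and> z \<sqsubset>\<^bsub>L\<^esub> y" if "z \<in> insert x K" for z
    using that K'(1,2) lless_trans[OF _ assms(5) _ assms(3,4)] assms(3,5) by blast
  moreover have "z \<sqsubseteq>\<^bsub>L\<^esub> w \<or> w \<sqsubseteq>\<^bsub>L\<^esub> z" if "z \<in> insert x K" "w \<in> insert x K" for z w
    using that K'(2)[of z] K'(2)[of w] K'(3)[of z w] assms(3) by (auto simp: lless_eq)
  ultimately have "insert x K \<in> chains y" unfolding chains_def by blast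
  then have "card (insert x K) \<le> poset_rank L y" unfolding rank using fin by (intro Max_ge) auto
  moreover have "finite K" using K'(1) assms(2) finite_subset by blast
  ultimately show ?thesis using K(2) \<open>x \<notin> K\<close> by simp
qed

section \<open>Chains sorted by the first entry of their index lists\<close>

definition copies :: "'l set \<Rightarrow> ('l \<Rightarrow> 'l list \<Rightarrow> 'u::zero) \<Rightarrow> 'l list \<Rightarrow> 'u" where
  "copies I W = (\<lambda>c. case c of [] \<Rightarrow> 0 | y # c' \<Rightarrow> if y \<in> I then W y c' else 0)"

text \<open>The projection onto the components indexed by \<open>I\<close>; with \<open>I\<close>
  the elements below \<open>z\<close> it truncates to the subcomplex of \<open>z\<close>. It is
  meant for positive degrees and kills chains of degree 0.\<close>

definition part_on :: "'l set \<Rightarrow> ('l list \<Rightarrow> 'u::zero) \<Rightarrow> 'l list \<Rightarrow> 'u" where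
  "part_on I g = (\<lambda>c. case c of [] \<Rightarrow> 0 | y # c' \<Rightarrow> if y \<in> I then g c else 0)"

lemma sum_fun_apply: "(\<Sum>i\<in>I. h i) c = (\<Sum>i\<in>I. h i c)"
  by (induction I rule: infinite_finite_induct) auto

lemma copies_eq_sum:
  fixes W :: "'l \<Rightarrow> 'l list \<Rightarrow> 'u::ab_group_add"
  assumes "finite I"
  shows "copies I W = (\<Sum>y\<in>I. copy_at y (W y))"
proof
  fix c
  show "copies I W c = (\<Sum>y\<in>I. copy_at y (W y)) c"
    unfolding sum_fun_apply
    by (cases c) (auto simp: copies_def copy_at_def assms)
qed

lemma copies_cong: "(\<And>y. y \<in> I \<Longrightarrow> W y = W' y) \<Longrightarrow> copies I W = copies I W'"
  by (auto simp: copies_def fun_eq_iff split: list.splits)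

lemma copies_restrict:
  "J \<subseteq> I \<Longrightarrow> (\<And>y. y \<in> I \<Longrightarrow> y \<notin> J \<Longrightarrow> W y = 0) \<Longrightarrow> copies I W = copies J W"
  by (auto simp: copies_def fun_eq_iff split: list.splits)

lemma part_on_copies: "part_on J (copies I W) = copies (I \<inter> J) W"
  by (auto simp: copies_def part_on_def fun_eq_iff split: list.splits)

lemma strip_copies:
  assumes "finite (carrier L)" "I \<subseteq> carrier L"
  shows "strip L (copies I W) = (\<Sum>y\<in>I. W y)"
proof
  fix c
  have "finite I" using assms finite_subset by blast
  have "strip L (copies I W) c = (\<Sum>y\<in>carrier L. if y \<in> I then W y c else 0)"
    by (simp add: strip_def copies_def)
  also have "\<dots> = (\<Sum>y\<in>I. W y) c"
    unfolding sum_fun_apply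
    using assms by (simp add: sum.inter_restrict[symmetric] Int_absorb1)
  finally show "strip L (copies I W) c = (\<Sum>y\<in>I. W y) c" .
qed

lemma module_hom_part_on: "module s \<Longrightarrow> module_hom (fun_scale s) (fun_scale s) (part_on I)"
  unfolding module_hom_def module_hom_axioms_def
  by (auto simp: module_fun_scale part_on_def fun_scale_def fun_eq_iff module.scale_zero_right
      split: list.splits)

lemma module_hom_strip: "module s \<Longrightarrow> module_hom (fun_scale s) (fun_scale s) (strip L)"
  unfolding module_hom_def module_hom_axioms_def
  by (auto simp: module_fun_scale strip_add strip_scale)

lemma module_hom_comp_left:
  "module_hom s s A \<Longrightarrow> module_hom (fun_scale s) (fun_scale s) ((\<circ>) A)"
  unfolding module_hom_def module_hom_axioms_def
  by (auto simp: module_fun_scale fun_scale_def fun_eq_iff)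

lemma strip_comp: "module_hom s s A \<Longrightarrow> strip L (A \<circ> g) = A \<circ> strip L g"
  by (auto simp: strip_def fun_eq_iff module_hom.sum)

lemma comp_base: "module_hom s s A \<Longrightarrow> A \<circ> base u = base (A u)"
  by (auto simp: base_def fun_eq_iff module_hom.zero)

lemma comp_copy_at: "module_hom s s A \<Longrightarrow> A \<circ> copy_at x g = copy_at x (A \<circ> g)"
  by (auto simp: copy_at_def fun_eq_iff module_hom.zero split: list.splits)

text \<open>The family \<open>f\<^sub>a\<close> of the overview, for an abstract atomic datum. The
  assumption \<open>diamond\<close> is a form of semimodularity, with \<open>y\<close> in the role
  of the join of \<open>x\<close> and \<open>x'\<close>; it is phrased below a common upper bound
  \<open>z\<close> because \<open>L\<close> is only a poset here.\<close>

locale homotopy_datum =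
  fixes s :: "'r::comm_ring_1 \<Rightarrow> 'u::ab_group_add \<Rightarrow> 'u"
    and L :: "('l, 'c) gorder_scheme" and U0 :: "'u set" and U :: "'l \<Rightarrow> 'u set" and b :: 'l
    and f :: "'l \<Rightarrow> 'u \<Rightarrow> 'u"
  assumes m: "module s" and po: "partial_order L" and fin: "finite (carrier L)"
    and graded: "\<And>y x. covers L y x \<Longrightarrow> poset_rank L x = Suc (poset_rank L y)"
    and bot: "level L 0 = {b}" and least: "\<And>x. x \<in> carrier L \<Longrightarrow> b \<sqsubseteq>\<^bsub>L\<^esub> x"
    and diamond: "\<And>t x x' z. covers L t x' \<Longrightarrow> t \<sqsubseteq>\<^bsub>L\<^esub> x \<Longrightarrow> \<not> x' \<sqsubseteq>\<^bsub>L\<^esub> x \<Longrightarrow>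
      x \<in> carrier L \<Longrightarrow> z \<in> carrier L \<Longrightarrow> x \<sqsubseteq>\<^bsub>L\<^esub> z \<Longrightarrow> x' \<sqsubseteq>\<^bsub>L\<^esub> z \<Longrightarrow>
      \<exists>!y. covers L x y \<and> y \<sqsubseteq>\<^bsub>L\<^esub> z \<and> x' \<sqsubseteq>\<^bsub>L\<^esub> y"
    and U0: "module.subspace s U0"
    and U: "\<And>a. a \<in> level L 1 \<Longrightarrow> module.subspace s (U a)" "\<And>a. a \<in> level L 1 \<Longrightarrow> U a \<subseteq> U0"
    and f: "\<And>a. a \<in> level L 1 \<Longrightarrow> module_hom s s (f a)"
      "\<And>a u. a \<in> level L 1 \<Longrightarrow> u \<in> U0 \<Longrightarrow> f a u \<in> U a"
    and f_preserves: "\<And>a z u. a \<in> level L 1 \<Longrightarrow> z \<in> carrier L \<Longrightarrow> a \<sqsubseteq>\<^bsub>L\<^esub> z \<Longrightarrow> u \<in> U a \<Longrightarrow>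
      (\<Sum>a' \<in> {a' \<in> level L 1. a' \<sqsubseteq>\<^bsub>L\<^esub> z}. f a' u) \<in> U a"
begin

sublocale partial_order L by (rule po)
interpretation S: module s by (rule m)
interpretation F: module "fun_scale s" by (rule module_fun_scale[OF m])

abbreviation P where "P \<equiv> piece (minimal_complex s L U0 U)"

section \<open>Pieces of the minimal complex, their boundaries and supports\<close>

lemma atoms: "a \<in> level L 1 \<Longrightarrow> covers L b a"
proof -
  assume a: "a \<in> level L 1"
  have b: "b \<in> level L 0" using bot by auto
  have "z \<in> carrier L \<Longrightarrow> b \<sqsubset>\<^bsub>L\<^esub> z \<Longrightarrow> z \<sqsubset>\<^bsub>L\<^esub> a \<Longrightarrow> False" for z
    using lless_imp_poset_rank_less[OF po fin, of b z] lless_imp_poset_rank_less[OF po fin, of z a] a b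
    by (auto simp: level_def)
  moreover have "b \<noteq> a" using a b by (auto simp: level_def)
  ultimately show ?thesis using a b least[of a] by (auto simp: covers_def level_def lless_eq)
qed

lemma compatible: "compatible_grading L (minimal_complex s L U0 U)"
  by (rule minimal_complex_compatible[of s L b U0 U]) (fact m fin graded bot atoms U0 U)+

lemma P_bot: "P b = base ` U0"
  by (rule piece_rank_0[of s L b U0 U]) (fact m fin graded bot atoms U0 U)+

lemma P_Suc_Suc:
  assumes "x \<in> level L (Suc (Suc i))"
  shows "P x = copy_at x ` {g \<in> internal_sum P {y. covers L y x}. strip L g = 0}"
  by (rule piece_eq[of s L b U0 U]) (fact m fin graded bot atoms U0 U assms)+

lemma P_subspace:
  assumes "x \<in> level L i"
  shows "module.subspace (fun_scale s) (P x)"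
  by (rule subspace_piece[of s L b U0 U]) (fact m fin graded bot atoms U0 U assms)+

lemma P_Suc_0: "a \<in> level L 1 \<Longrightarrow> P a = copy_at a ` base ` U a"
  by (auto simp: minimal_complex_def level_def)


lemma P_sum_subspace: "I \<subseteq> level L i \<Longrightarrow> module.subspace (fun_scale s) (internal_sum P I)"
  by (rule subspace_internal_sum[OF module_fun_scale[OF m]]) (use P_subspace in blast)

lemma finite_level: "finite (level L i)"
  using fin by (simp add: level_def)

lemma P_sum_mono: "I \<subseteq> J \<Longrightarrow> J \<subseteq> level L i \<Longrightarrow> internal_sum P I \<subseteq> internal_sum P J"
  using internal_sum_mono[OF module_fun_scale[OF m], of J I P] finite_level finite_subset P_subspace
  by blast

lemma P_in_sum: "x \<in> I \<Longrightarrow> I \<subseteq> level L i \<Longrightarrow> v \<in> P x \<Longrightarrow> v \<in> internal_sum P I"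
  using internal_sum_piece[OF module_fun_scale[OF m], of I P x v] finite_level finite_subset P_subspace
  by blast

lemma covers_below: "x \<in> level L (Suc i) \<Longrightarrow> {y. covers L y x} \<subseteq> level L i"
  using graded by (fastforce simp: level_def covers_def)

lemma covers_above: "x \<in> level L i \<Longrightarrow> {y. covers L x y} \<subseteq> level L (Suc i)"
  using graded by (fastforce simp: level_def covers_def)

text \<open>Rank is strictly monotone, so comparable elements of consecutive ranks have nothing in
  between.\<close>

lemma covers_iff:
  assumes "y \<in> level L (Suc i)"
  shows "covers L x y \<longleftrightarrow> x \<in> level L i \<and> x \<sqsubseteq>\<^bsub>L\<^esub> y"
proof
  assume "covers L x y"
  then show "x \<in> level L i \<and> x \<sqsubseteq>\<^bsub>L\<^esub> y"
    using covers_below[OF assms] by (auto simp: covers_def lless_eq)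
next
  assume x: "x \<in> level L i \<and> x \<sqsubseteq>\<^bsub>L\<^esub> y"
  have "z \<in> carrier L \<Longrightarrow> x \<sqsubset>\<^bsub>L\<^esub> z \<Longrightarrow> z \<sqsubset>\<^bsub>L\<^esub> y \<Longrightarrow> False" for z
    using lless_imp_poset_rank_less[OF po fin, of x z] lless_imp_poset_rank_less[OF po fin, of z y]
      x assms by (auto simp: level_def)
  then show "covers L x y" using x assms by (auto simp: covers_def level_def lless_eq)
qed

lemma strip_P:
  assumes "x \<in> level L (Suc i)" "v \<in> P x"
  shows "strip L v \<in> internal_sum P {y. covers L y x}"
proof -
  have "bd (minimal_complex s L U0 U) (poset_rank L x) ` P x \<subseteq> internal_sum P {y. covers L y x}"
    using compatible assms unfolding compatible_grading_def level_def by (metis (mono_tags, lifting) mem_Collect_eq zero_less_Suc)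
  then show ?thesis using assms(2) by (auto simp: minimal_complex_def)
qed

text \<open>A piece of positive rank consists of copies indexed by its own element. Hence the
  boundary is injective on a single piece.\<close>

lemma P_copy:
  assumes "x \<in> level L (Suc i)" "v \<in> P x"
  shows "v = copy_at x (strip L v)"
proof -
  have "v \<in> range (copy_at x)"
  proof (cases i)
    case 0
    then show ?thesis using assms P_Suc_0[of x] by auto
  next
    case (Suc j)
    then show ?thesis using assms P_Suc_Suc[of x j] by auto
  qed
  then show ?thesis using assms(1) fin by (auto simp: strip_copy_at level_def)
qed

lemma strip_strip: "x \<in> level L (Suc (Suc i)) \<Longrightarrow> v \<in> P x \<Longrightarrow> strip L (strip L v) = 0"
  using P_Suc_Suc[of x i] by (auto simp: strip_copy_at level_def fin)

lemma strip_inj: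
  assumes "x \<in> level L (Suc i)" "v \<in> P x" "strip L v = 0"
  shows "v = 0"
  using P_copy[OF assms(1,2)] unfolding assms(3)
  by (auto simp: copy_at_def fun_eq_iff split: list.splits)

lemma P_support:
  assumes "x \<in> level L (Suc i)" "v \<in> P x"
  shows "v [] = 0" and "y \<noteq> x \<Longrightarrow> v (y # c) = 0"
  by (subst P_copy[OF assms], simp add: copy_at_def)+

lemma P_sum_support:
  assumes "v \<in> internal_sum P I" "I \<subseteq> level L (Suc i)"
  shows "v [] = 0" and "y \<notin> I \<Longrightarrow> v (y # c) = 0"
proof -
  show "v [] = 0" using assms(1)
    by (induction rule: internal_sum_induct) (use P_support(1) assms(2) in auto)
  show "v (y # c) = 0" if "y \<notin> I" using assms(1)
  proof (induction rule: internal_sum_induct)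
    case (piece x u)
    then show ?case using P_support(2)[of x i u y c] assms(2) that by auto
  qed auto
qed

lemma part_on_P:
  assumes "x \<in> level L (Suc i)" "v \<in> P x"
  shows "part_on I v = (if x \<in> I then v else 0)"
proof
  fix c show "part_on I v c = (if x \<in> I then v else 0) c"
    using P_support[OF assms] by (cases c; cases "hd c = x") (auto simp: part_on_def)
qed

lemma part_on_P_sum:
  assumes "v \<in> internal_sum P J" "J \<subseteq> level L (Suc i)"
  shows "part_on I v \<in> internal_sum P (J \<inter> I)"
proof -
  interpret p: module_hom "fun_scale s" "fun_scale s" "part_on I" by (rule module_hom_part_on[OF m])
  have sub: "module.subspace (fun_scale s) (internal_sum P (J \<inter> I))"
    using assms(2) by (intro P_sum_subspace) auto
  from assms(1) show ?thesis
  proof (induction rule: internal_sum_induct)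
    case (piece x u)
    then have "part_on I u = (if x \<in> I then u else 0)" using part_on_P assms(2) by blast
    then show ?case
      using piece assms(2) P_in_sum[of x "J \<inter> I" "Suc i" u] F.subspace_0[OF sub] by auto
  qed (simp_all only: p.add p.zero F.subspace_0[OF sub] F.subspace_add[OF sub])
qed

text \<open>Pieces of positive rank arise from the \<open>U a\<close> by copying, summing and taking
  kernels of \<open>strip L\<close>. Postcomposition with a linear map respects all three, so
  induction on the rank applies.\<close>

lemma comp_P:
  assumes A: "module_hom s s A" "\<And>a u. a \<in> level L 1 \<Longrightarrow> a \<sqsubseteq>\<^bsub>L\<^esub> z \<Longrightarrow> u \<in> U a \<Longrightarrow> A u \<in> U a"
    and z: "z \<in> carrier L"
  shows "x \<in> level L (Suc i) \<Longrightarrow> x \<sqsubseteq>\<^bsub>L\<^esub> z \<Longrightarrow> v \<in> P x \<Longrightarrow> A \<circ> v \<in> P x"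
proof (induction i arbitrary: x v)
  case 0
  then obtain u where u: "u \<in> U x" "v = copy_at x (base u)" by (auto simp: P_Suc_0)
  have "A \<circ> v = copy_at x (base (A u))" by (simp only: u(2) comp_copy_at[OF A(1)] comp_base[OF A(1)])
  then show ?case using A(2)[of x u] 0 u by (auto simp: P_Suc_0)
next
  case (Suc i)
  interpret A: module_hom "fun_scale s" "fun_scale s" "(\<circ>) A" by (rule module_hom_comp_left[OF A(1)])
  let ?I = "{y. covers L y x}"
  have sub: "module.subspace (fun_scale s) (internal_sum P ?I)"
    using covers_below[OF Suc.prems(1)] by (rule P_sum_subspace)
  obtain g where g: "g \<in> internal_sum P ?I" "strip L g = 0" "v = copy_at x g"
    using Suc.prems by (auto simp: P_Suc_Suc)
  from g(1) have "A \<circ> g \<in> internal_sum P ?I"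
  proof (induction rule: internal_sum_induct)
    case (piece y u)
    have y: "y \<in> level L (Suc i)" "y \<sqsubseteq>\<^bsub>L\<^esub> z"
      using piece covers_below[OF Suc.prems(1)] Suc.prems z le_trans[of y x z]
      by (auto simp: covers_def lless_eq level_def)
    then show ?case
      using piece Suc.IH[of y u] P_in_sum[OF _ covers_below[OF Suc.prems(1)]] by blast
  qed (simp_all only: A.add A.zero F.subspace_0[OF sub] F.subspace_add[OF sub])
  moreover have "strip L (A \<circ> g) = 0" by (simp only: strip_comp[OF A(1)] g(2) A.zero)
  ultimately show ?case
    using Suc.prems by (auto simp: P_Suc_Suc g(3) comp_copy_at[OF A(1)])
qed

text \<open>This turns an inverse on the submodules \<open>U a\<close> into an inverse on chains of
  positive degree.\<close>

lemma comp_P_id: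
  assumes A: "module_hom s s A" "\<And>a u. a \<in> level L 1 \<Longrightarrow> a \<sqsubseteq>\<^bsub>L\<^esub> z \<Longrightarrow> u \<in> U a \<Longrightarrow> A u = u"
    and z: "z \<in> carrier L"
  shows "x \<in> level L (Suc i) \<Longrightarrow> x \<sqsubseteq>\<^bsub>L\<^esub> z \<Longrightarrow> v \<in> P x \<Longrightarrow> A \<circ> v = v"
proof (induction i arbitrary: x v)
  case 0
  then obtain u where u: "u \<in> U x" "v = copy_at x (base u)" by (auto simp: P_Suc_0)
  have "A \<circ> v = copy_at x (base (A u))" by (simp only: u(2) comp_copy_at[OF A(1)] comp_base[OF A(1)])
  then show ?case using A(2)[of x u] 0 u by (auto simp: P_Suc_0)
next
  case (Suc i)
  interpret A: module_hom "fun_scale s" "fun_scale s" "(\<circ>) A" by (rule module_hom_comp_left[OF A(1)])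
  obtain g where g: "g \<in> internal_sum P {y. covers L y x}" "v = copy_at x g"
    using Suc.prems by (auto simp: P_Suc_Suc)
  from g(1) have "A \<circ> g = g"
  proof (induction rule: internal_sum_induct)
    case (piece y u)
    have y: "y \<in> level L (Suc i)" "y \<sqsubseteq>\<^bsub>L\<^esub> z"
      using piece covers_below[OF Suc.prems(1)] Suc.prems z le_trans[of y x z]
      by (auto simp: covers_def lless_eq level_def)
    then show ?case
      using piece Suc.IH[of y u] by blast
  qed (simp_all only: A.add A.zero)
  then show ?case by (simp add: g(2) comp_copy_at[OF A(1)])
qed

section \<open>The operators \<open>\<Delta>\<^sub>z\<close> and the maps \<open>d\<close> with
  \<open>d\<partial> + \<partial>d = \<Delta>\<^sub>z\<close>\<close>

definition laplacian :: "'l \<Rightarrow> 'u \<Rightarrow> 'u" where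
  "laplacian z u = (\<Sum>a \<in> {a \<in> level L 1. a \<sqsubseteq>\<^bsub>L\<^esub> z}. f a u)"

lemma module_hom_laplacian: "module_hom s s (laplacian z)"
  unfolding module_hom_def module_hom_axioms_def
  by (auto simp: m laplacian_def f(1)[THEN module_hom.add] f(1)[THEN module_hom.scale]
      S.scale_sum_right simp flip: sum.distrib intro!: sum.cong)

lemma laplacian_P:
  "x \<in> level L (Suc i) \<Longrightarrow> x \<sqsubseteq>\<^bsub>L\<^esub> z \<Longrightarrow> z \<in> carrier L \<Longrightarrow> v \<in> P x \<Longrightarrow> laplacian z \<circ> v \<in> P x"
  by (rule comp_P[OF module_hom_laplacian, of z]) (simp_all only: laplacian_def f_preserves)

text \<open>This is the map \<open>d\<close> out of degree \<open>i\<close>. To make sense on sums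
  of pieces, the component at \<open>y\<close> first selects the part of \<open>g\<close> at the
  elements covered by \<open>y\<close>. Placing the prescribed boundary at index \<open>y\<close> by
  \<open>copies\<close> requires no cycle condition; that condition is checked in
  \<open>htpy_step\<close>.\<close>

primrec htpy :: "nat \<Rightarrow> ('l list \<Rightarrow> 'u) \<Rightarrow> 'l list \<Rightarrow> 'u" where
  "htpy 0 g = copies (level L 1) (\<lambda>a. base (f a (g [])))"
| "htpy (Suc i) g = copies (level L (Suc (Suc i))) (\<lambda>y.
     (laplacian y \<circ> part_on {x. covers L x y} g) -
     part_on {x. x \<sqsubseteq>\<^bsub>L\<^esub> y} (htpy i (strip L (part_on {x. covers L x y} g))))"

lemma module_hom_copies:
  assumes "\<And>y. y \<in> I \<Longrightarrow> module_hom (fun_scale s) (fun_scale s) (W y)"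
  shows "module_hom (fun_scale s) (fun_scale s) (\<lambda>g. copies I (\<lambda>y. W y g))"
  unfolding module_hom_def module_hom_axioms_def
proof (intro conjI allI module_fun_scale m)
  fix g h r
  show "copies I (\<lambda>y. W y (g + h)) = copies I (\<lambda>y. W y g) + copies I (\<lambda>y. W y h)"
  proof
    fix c show "copies I (\<lambda>y. W y (g + h)) c = (copies I (\<lambda>y. W y g) + copies I (\<lambda>y. W y h)) c"
      using module_hom.add[OF assms] by (cases c) (auto simp: copies_def)
  qed
  show "copies I (\<lambda>y. W y (fun_scale s r g)) = fun_scale s r (copies I (\<lambda>y. W y g))"
  proof
    fix c show "copies I (\<lambda>y. W y (fun_scale s r g)) c = fun_scale s r (copies I (\<lambda>y. W y g)) c"
      using module_hom.scale[OF assms] by (cases c) (auto simp: copies_def fun_scale_def)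
  qed
qed

lemma module_hom_htpy: "module_hom (fun_scale s) (fun_scale s) (htpy i)"
proof (induction i)
  case 0
  have "module_hom (fun_scale s) (fun_scale s) (\<lambda>g. base (f a (g [])))" if "a \<in> level L 1" for a
    unfolding module_hom_def module_hom_axioms_def using f(1)[OF that]
    by (auto simp: module_fun_scale m base_def fun_scale_def fun_eq_iff module_hom.add module_hom.scale)
  then show ?case unfolding htpy.simps by (rule module_hom_copies)
next
  case (Suc i)
  note [simp] = F.module_axioms
  interpret F2: module_pair "fun_scale s" "fun_scale s" by unfold_locales
  have A: "module_hom (fun_scale s) (fun_scale s) (\<lambda>g. (laplacian y \<circ> part_on {x. covers L x y} g))"
    for y
    using module_hom_compose[OF module_hom_part_on[OF m] module_hom_comp_left[OF module_hom_laplacian]]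
    unfolding comp_def[of "(\<circ>) _"] .
  have B: "module_hom (fun_scale s) (fun_scale s)
      (\<lambda>g. part_on {x. x \<sqsubseteq>\<^bsub>L\<^esub> y} (htpy i (strip L (part_on {x. covers L x y} g))))" for y
    using module_hom_compose[OF module_hom_compose[OF module_hom_compose[OF module_hom_part_on[OF m]
      module_hom_strip[OF m]] Suc.IH] module_hom_part_on[OF m]]
    unfolding comp_def .
  show ?case unfolding htpy.simps by (rule module_hom_copies) (rule F2.module_hom_sub[OF A B])
qed

interpretation st: module_hom "fun_scale s" "fun_scale s" "strip L" by (rule module_hom_strip[OF m])
interpretation pt: module_hom "fun_scale s" "fun_scale s" "part_on I" for I by (rule module_hom_part_on[OF m])
interpretation lp: module_hom "fun_scale s" "fun_scale s" "(\<circ>) (laplacian z)" for z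
  by (rule module_hom_comp_left[OF module_hom_laplacian])
interpretation ht: module_hom "fun_scale s" "fun_scale s" "htpy i" for i by (rule module_hom_htpy)

abbreviation below where "below z \<equiv> {x. x \<sqsubseteq>\<^bsub>L\<^esub> z}"

text \<open>The covers of \<open>x\<close> below \<open>z\<close> partition the atoms below
  \<open>z\<close> that are not below \<open>x\<close>: each such atom lies below exactly one of
  these covers.\<close>

lemma laplacian_sum:
  assumes "x \<in> carrier L" "z \<in> carrier L" "x \<sqsubseteq>\<^bsub>L\<^esub> z"
  shows "(\<Sum>y | covers L x y \<and> y \<sqsubseteq>\<^bsub>L\<^esub> z. laplacian y u - laplacian x u) = laplacian z u - laplacian x u"
proof -
  define A where "A y = {a \<in> level L 1. a \<sqsubseteq>\<^bsub>L\<^esub> y \<and> \<not> a \<sqsubseteq>\<^bsub>L\<^esub> x}" for y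
  have diff: "laplacian y u - laplacian x u = (\<Sum>a\<in>A y. f a u)"
    if "x \<sqsubseteq>\<^bsub>L\<^esub> y" "y \<in> carrier L" for y
  proof -
    have "{a \<in> level L 1. a \<sqsubseteq>\<^bsub>L\<^esub> y} = {a \<in> level L 1. a \<sqsubseteq>\<^bsub>L\<^esub> x} \<union> A y"
      using le_trans[OF _ that(1) _ assms(1) that(2)] by (auto simp: A_def level_def)
    moreover have "{a \<in> level L 1. a \<sqsubseteq>\<^bsub>L\<^esub> x} \<inter> A y = {}" by (auto simp: A_def)
    ultimately show ?thesis
      using finite_level[of 1] by (simp add: laplacian_def A_def sum.union_disjoint)
  qed
  let ?I = "{y. covers L x y \<and> y \<sqsubseteq>\<^bsub>L\<^esub> z}"
  \<comment> \<open>This is \<open>diamond\<close> with \<open>t\<close> the least element, which is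
    below \<open>x\<close> and is covered by the atom.\<close>
  have ex1: "\<exists>!y. y \<in> ?I \<and> a \<sqsubseteq>\<^bsub>L\<^esub> y" if "a \<in> A z" for a
    using diamond[OF atoms least[OF assms(1)], of a z] that assms unfolding A_def by auto
  have "A z = (\<Union>y\<in>?I. A y)"
  proof (intro equalityI subsetI)
    fix a assume "a \<in> A z"
    then show "a \<in> (\<Union>y\<in>?I. A y)" using ex1[of a] by (auto simp: A_def)
  next
    fix a assume "a \<in> (\<Union>y\<in>?I. A y)"
    then obtain y where y: "covers L x y" "y \<sqsubseteq>\<^bsub>L\<^esub> z" "a \<in> A y" by auto
    then show "a \<in> A z" using le_trans[of a y z] assms(2) by (auto simp: A_def covers_def level_def)
  qed
  then have "(\<Sum>a\<in>A z. f a u) = (\<Sum>a\<in>(\<Union>y\<in>?I. A y). f a u)" by simp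
  also have "\<dots> = (\<Sum>y\<in>?I. \<Sum>a\<in>A y. f a u)"
  proof (rule sum.UNION_disjoint)
    show "finite ?I" by (rule finite_subset[OF _ fin]) (auto simp: covers_def)
    show "\<forall>y\<in>?I. finite (A y)" using finite_level[of 1] by (auto simp: A_def)
    show "\<forall>i\<in>?I. \<forall>j\<in>?I. i \<noteq> j \<longrightarrow> A i \<inter> A j = {}"
    proof (intro ballI impI equals0I)
      fix i j a assume *: "i \<in> ?I" "j \<in> ?I" "i \<noteq> j" "a \<in> A i \<inter> A j"
      then have "a \<in> A z" using \<open>A z = (\<Union>y\<in>?I. A y)\<close> by auto
      then show False using ex1[of a] * unfolding A_def by blast
    qed
  qed
  also have "\<dots> = (\<Sum>y\<in>?I. laplacian y u - laplacian x u)"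
    by (intro sum.cong refl diff[symmetric]) (auto simp: covers_def lless_eq)
  finally show ?thesis using diff[OF assms(3,2)] by simp
qed

lemma finite_covers: "finite {y. covers L x y}" "finite {y. covers L y x}"
  by (rule finite_subset[OF _ fin], auto simp: covers_def)+

lemma covers_le: "covers L x y \<Longrightarrow> x \<sqsubseteq>\<^bsub>L\<^esub> y"
  by (auto simp: covers_def lless_eq)

text \<open>The induction step from degree \<open>i\<close> to \<open>Suc i\<close>: A locates the
  image of \<open>d\<close>, and B is the homotopy identity. The chains \<open>W y\<close> are the
  boundaries prescribed for the components of \<open>d v\<close>. They are shown to be cycles, and
  their sum over the covers of \<open>x\<close> below \<open>z\<close> is evaluated.\<close>

lemma htpy_step:
  assumes A: "\<And>x v. x \<in> level L i \<Longrightarrow> v \<in> P x \<Longrightarrow> htpy i v \<in> internal_sum P {y. covers L x y}"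
    and B: "\<And>z v. z \<in> carrier L \<Longrightarrow> v \<in> internal_sum P {x \<in> level L i. x \<sqsubseteq>\<^bsub>L\<^esub> z} \<Longrightarrow>
      strip L (part_on (below z) (htpy i v)) =
      (laplacian z \<circ> v) - (if i = 0 then 0 else part_on (below z) (htpy (i - 1) (strip L v)))"
    and x: "x \<in> level L (Suc i)" and v: "v \<in> P x"
  shows "htpy (Suc i) v \<in> internal_sum P {y. covers L x y}"
    and "z \<in> carrier L \<Longrightarrow> x \<sqsubseteq>\<^bsub>L\<^esub> z \<Longrightarrow> strip L (part_on (below z) (htpy (Suc i) v)) =
      (laplacian z \<circ> v) - part_on (below z) (htpy i (strip L v))"
proof -
  define u where "u = htpy i (strip L v)"
  define W where "W y = (laplacian y \<circ> v) - part_on (below y) u" for y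
  have xc: "x \<in> carrier L" using x by (auto simp: level_def)
  \<comment> \<open>These elements are reached from \<open>x\<close> by one step down and one step
    up; \<open>u\<close> is supported on them.\<close>
  let ?N = "{x'. \<exists>t. covers L t x \<and> covers L t x'}"
  have N: "?N \<subseteq> level L (Suc i)"
    using covers_below[OF x] covers_above by blast
  have sv: "strip L v \<in> internal_sum P {t. covers L t x}" using x v by (rule strip_P)
  have subN: "module.subspace (fun_scale s) (internal_sum P ?N)" using N by (rule P_sum_subspace)
  have u: "u \<in> internal_sum P ?N"
    unfolding u_def using sv
  proof (induction rule: internal_sum_induct)
    case (piece t w)
    have "htpy i w \<in> internal_sum P {y. covers L t y}"
      using piece covers_below[OF x] by (intro A) auto
    moreover have "internal_sum P {y. covers L t y} \<subseteq> internal_sum P ?N"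
      using piece by (intro P_sum_mono[OF _ N]) auto
    ultimately show ?case by blast
  qed (simp_all only: ht.zero ht.add F.subspace_0[OF subN] F.subspace_add[OF subN])
  \<comment> \<open>The identity B is applied to the boundary of \<open>v\<close>. Its
    \<open>d\<partial>\<close> term vanishes because the boundary of a boundary is 0, or is absent
    when \<open>i = 0\<close>.\<close>
  have strip_u: "strip L (part_on (below y) u) = laplacian y \<circ> strip L v"
    if y: "x \<sqsubseteq>\<^bsub>L\<^esub> y" "y \<in> carrier L" for y
  proof -
    have "{t. covers L t x} \<subseteq> {t \<in> level L i. t \<sqsubseteq>\<^bsub>L\<^esub> y}"
      using covers_below[OF x] le_trans[OF _ y(1) _ xc y(2)] by (auto simp: covers_def lless_eq)
    then have "strip L v \<in> internal_sum P {t \<in> level L i. t \<sqsubseteq>\<^bsub>L\<^esub> y}"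
      using sv P_sum_mono[of "{t. covers L t x}" "{t \<in> level L i. t \<sqsubseteq>\<^bsub>L\<^esub> y}" i] by auto
    then have "strip L (part_on (below y) u) = (laplacian y \<circ> strip L v) -
        (if i = 0 then 0 else part_on (below y) (htpy (i - 1) (strip L (strip L v))))"
      unfolding u_def by (rule B[OF y(2)])
    moreover have "strip L (strip L v) = 0" if "i \<noteq> 0"
      using strip_strip[of x "i - 1" v] x v that by auto
    ultimately show ?thesis
      by (cases "i = 0") (simp_all only: ht.zero pt.zero if_True if_False diff_0_right not_True_eq_False not_False_eq_True simp_thms)
  qed
  have strip_W: "strip L (W y) = 0" if y: "x \<sqsubseteq>\<^bsub>L\<^esub> y" "y \<in> carrier L" for y
    unfolding W_def st.diff strip_u[OF y] strip_comp[OF module_hom_laplacian] by (rule diff_self)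
  have W: "W y \<in> internal_sum P {t. covers L t y}" if y: "covers L x y" for y
  proof -
    have yl: "y \<in> level L (Suc (Suc i))" using y covers_above[OF x] by auto
    have sub: "module.subspace (fun_scale s) (internal_sum P {t. covers L t y})"
      using covers_below[OF yl] by (rule P_sum_subspace)
    have "laplacian y \<circ> v \<in> internal_sum P {t. covers L t y}"
      using P_in_sum[OF _ covers_below[OF yl] laplacian_P[OF x covers_le[OF y] _ v]] y
      by (auto simp: covers_def)
    moreover have "?N \<inter> below y \<subseteq> {t. covers L t y}"
      using N by (auto simp: covers_iff[OF yl])
    then have "part_on (below y) u \<in> internal_sum P {t. covers L t y}"
      using part_on_P_sum[OF u N] P_sum_mono[OF _ covers_below[OF yl]] by blast
    ultimately show ?thesis unfolding W_def by (rule F.subspace_diff[OF sub])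
  qed
  \<comment> \<open>All elements of \<open>?N\<close> have the rank of \<open>x\<close>, so only
    \<open>x\<close> itself can be below \<open>x\<close>. Thus \<open>W x\<close> is a cycle in the
    single piece \<open>P x\<close>, where the boundary is injective.\<close>
  have "W x = 0"
  proof -
    have "x' = x" if "x' \<in> ?N" "x' \<sqsubseteq>\<^bsub>L\<^esub> x" for x'
    proof (rule ccontr)
      assume "x' \<noteq> x"
      then have "poset_rank L x' < poset_rank L x"
        using that N xc by (intro lless_imp_poset_rank_less[OF po fin]) (auto simp: lless_eq covers_def)
      then show False using that N x by (auto simp: level_def)
    qed
    then have "?N \<inter> below x \<subseteq> {x}" by auto
    then have "part_on (below x) u \<in> internal_sum P {x}"
      using part_on_P_sum[OF u N, of "below x"] P_sum_mono[of "?N \<inter> below x" "{x}" "Suc i"] x by blast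
    then have "part_on (below x) u \<in> P x" by (auto simp: internal_sum_def)
    then have "W x \<in> P x" unfolding W_def
      using laplacian_P[OF x _ xc v] xc by (intro F.subspace_diff[OF P_subspace[OF x]]) auto
    then show ?thesis using strip_inj[OF x] strip_W[of x] xc by auto
  qed
  \<comment> \<open>Since \<open>v\<close> lies in the piece of \<open>x\<close>, only the
    components at covers of \<open>x\<close> survive in the definition of
    \<open>htpy\<close>.\<close>
  have htpy: "htpy (Suc i) v = copies {y. covers L x y} W"
  proof -
    define W' where "W' y = (laplacian y \<circ> part_on {x. covers L x y} v) -
     part_on {x. x \<sqsubseteq>\<^bsub>L\<^esub> y} (htpy i (strip L (part_on {x. covers L x y} v)))" for y
    have "W' y = (if covers L x y then W y else 0)" for y
      unfolding W'_def W_def u_def part_on_P[OF x v]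
      by (cases "covers L x y") (simp_all only: if_True if_False mem_Collect_eq lp.zero st.zero ht.zero pt.zero diff_0_right)
    then show ?thesis
      unfolding htpy.simps W'_def[symmetric]
      by (subst copies_restrict[OF covers_above[OF x]]) (auto intro!: copies_cong)
  qed
  have sub: "module.subspace (fun_scale s) (internal_sum P {y. covers L x y})"
    using covers_above[OF x] by (rule P_sum_subspace)
  have "copy_at y (W y) \<in> P y" if "covers L x y" for y
    using W[OF that] strip_W[of y] that covers_le[OF that] covers_above[OF x]
    by (subst P_Suc_Suc[of y i]) (auto simp: covers_def)
  then show "htpy (Suc i) v \<in> internal_sum P {y. covers L x y}"
    unfolding htpy copies_eq_sum[OF finite_covers(1)]
    by (intro F.subspace_sum[OF sub] P_in_sum[OF _ covers_above[OF x]]) auto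
  assume z: "z \<in> carrier L" "x \<sqsubseteq>\<^bsub>L\<^esub> z"
  let ?I = "{y. covers L x y \<and> y \<sqsubseteq>\<^bsub>L\<^esub> z}"
  have I: "{y. covers L x y} \<inter> below z = ?I" by auto
  have finI: "finite ?I" by (rule finite_subset[OF _ fin]) (auto simp: covers_def)
  have "strip L (part_on (below z) (htpy (Suc i) v)) = (\<Sum>y\<in>?I. W y)"
    unfolding htpy part_on_copies I
    by (rule strip_copies[OF fin]) (auto simp: covers_def)
  \<comment> \<open>Both sides are compared at each index list. If the first entry is
    \<open>x\<close>, the claim is \<open>laplacian_sum\<close>. At another entry \<open>v\<close>
    vanishes, and \<open>diamond\<close> shows that the value of \<open>u\<close> occurs in exactly
    one \<open>W y\<close> if the entry is below \<open>z\<close>, and in none otherwise.\<close>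
  also have "\<dots> = (laplacian z \<circ> v) - part_on (below z) u"
  proof
    fix c
    have l0: "laplacian y 0 = 0" for y using module_hom.zero[OF module_hom_laplacian] .
    have v0: "v [] = 0" "\<And>y c. y \<noteq> x \<Longrightarrow> v (y # c) = 0" using P_support[OF x v] by auto
    have u0: "u [] = 0" "\<And>y c. y \<notin> ?N \<Longrightarrow> u (y # c) = 0" using P_sum_support[OF u N] by auto
    show "(\<Sum>y\<in>?I. W y) c = ((laplacian z \<circ> v) - part_on (below z) u) c"
    proof (cases c)
      case Nil
      then show ?thesis
        by (simp add: sum_fun_apply W_def v0 l0 part_on_def)
    next
      case (Cons x' c')
      show ?thesis
      proof (cases "x' = x")
        case True
        \<comment> \<open>This is the value of \<open>W x = 0\<close> at \<open>c\<close>.\<close>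
        have uc: "u c = laplacian x (v c)"
          using fun_cong[OF \<open>W x = 0\<close>, of c] xc by (simp add: W_def part_on_def Cons True)
        have "(\<Sum>y\<in>?I. W y) c = (\<Sum>y\<in>?I. laplacian y (v c) - laplacian x (v c))"
          unfolding sum_fun_apply W_def
          by (intro sum.cong refl) (use uc in \<open>auto simp: part_on_def Cons True covers_le\<close>)
        also have "\<dots> = laplacian z (v c) - laplacian x (v c)"
          using laplacian_sum[OF xc z] .
        also have "\<dots> = ((laplacian z \<circ> v) - part_on (below z) u) c"
          using z uc by (simp add: part_on_def Cons True)
        finally show ?thesis .
      next
        case False
        have "(\<Sum>y\<in>?I. W y) c = - (\<Sum>y\<in>?I. if x' \<sqsubseteq>\<^bsub>L\<^esub> y then u c else 0)"
          unfolding sum_fun_apply W_def sum_negf[symmetric]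
          by (intro sum.cong refl) (use False in \<open>auto simp: part_on_def Cons v0 l0\<close>)
        also have "(\<Sum>y\<in>?I. if x' \<sqsubseteq>\<^bsub>L\<^esub> y then u c else 0) = (if x' \<sqsubseteq>\<^bsub>L\<^esub> z then u c else 0)"
        \<comment> \<open>A nonzero value of \<open>u\<close> puts \<open>x'\<close> into
          \<open>?N\<close>, which supplies the common lower neighbour \<open>t\<close> for
          \<open>diamond\<close>.\<close>
        proof (cases "u c = 0")
          case nz: False
          then have "x' \<in> ?N" using u0(2)[of x' c'] Cons by auto
          then obtain t where t: "covers L t x" "covers L t x'" by auto
          \<comment> \<open>Both \<open>x\<close> and \<open>x'\<close> cover \<open>t\<close>, so
            they have the same rank.\<close>
          have "\<not> x' \<sqsubseteq>\<^bsub>L\<^esub> x"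
          proof
            assume "x' \<sqsubseteq>\<^bsub>L\<^esub> x"
            then have "poset_rank L x' < poset_rank L x"
              using t xc False by (intro lless_imp_poset_rank_less[OF po fin]) (auto simp: lless_eq covers_def)
            then show False using graded t by auto
          qed
          note ex1 = diamond[OF t(2) covers_le[OF t(1)] this xc z]
          show ?thesis
          proof (cases "x' \<sqsubseteq>\<^bsub>L\<^esub> z")
            case True
            from ex1[OF this] obtain y where y: "\<And>y'. y' \<in> ?I \<and> x' \<sqsubseteq>\<^bsub>L\<^esub> y' \<longleftrightarrow> y' = y" by auto
            have "(\<Sum>y'\<in>?I. if x' \<sqsubseteq>\<^bsub>L\<^esub> y' then u c else 0) = (\<Sum>y'\<in>?I. if y' = y then u c else 0)"
              using y by (intro sum.cong refl if_cong) auto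
            also have "\<dots> = u c" using finI y[of y] by (auto simp: sum.delta)
            finally show ?thesis using True by simp
          next
            case nle: False
            have "\<not> x' \<sqsubseteq>\<^bsub>L\<^esub> y" if "y \<in> ?I" for y
              using nle le_trans[of x' y z] that z t by (auto simp: covers_def)
            then show ?thesis using nle by (auto intro!: sum.neutral)
          qed
        qed (simp cong: if_cong)
        also have "- (if x' \<sqsubseteq>\<^bsub>L\<^esub> z then u c else 0) = ((laplacian z \<circ> v) - part_on (below z) u) c"
          using False by (simp add: part_on_def Cons v0 l0)
        finally show ?thesis .
      qed
    qed
  qed
  finally show "strip L (part_on (below z) (htpy (Suc i) v)) =
      (laplacian z \<circ> v) - part_on (below z) (htpy i (strip L v))" unfolding u_def .
qed


lemma htpy_0:
  assumes "v \<in> P b"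
  shows "htpy 0 v \<in> internal_sum P {y. covers L b y}"
    and "strip L (part_on (below z) (htpy 0 v)) = laplacian z \<circ> v"
proof -
  obtain u where u: "u \<in> U0" "v = base u" using assms by (auto simp: P_bot)
  have lv1: "{y. covers L b y} = level L 1"
    using atoms covers_above[of b 0] bot by auto
  have "copy_at a (base (f a u)) \<in> P a" if "a \<in> level L 1" for a
    unfolding P_Suc_0[OF that] using f(2)[OF that u(1)] by blast
  moreover have eq: "htpy 0 v = copies (level L 1) (\<lambda>a. base (f a u))"
    unfolding u(2) by (simp add: base_def)
  ultimately show "htpy 0 v \<in> internal_sum P {y. covers L b y}"
    unfolding lv1 copies_eq_sum[OF finite_level] eq
    by (intro F.subspace_sum[OF P_sum_subspace[of _ 1]] P_in_sum[of _ _ 1]) auto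
  have "strip L (part_on (below z) (htpy 0 v)) = (\<Sum>a \<in> level L 1 \<inter> below z. base (f a u))"
    unfolding eq part_on_copies by (rule strip_copies[OF fin]) (auto simp: level_def)
  also have "\<dots> = base (\<Sum>a \<in> level L 1 \<inter> below z. f a u)"
    by (auto simp: base_def fun_eq_iff sum_fun_apply)
  also have "level L 1 \<inter> below z = {a \<in> level L 1. a \<sqsubseteq>\<^bsub>L\<^esub> z}" by auto
  finally show "strip L (part_on (below z) (htpy 0 v)) = laplacian z \<circ> v"
    by (simp only: u(2) comp_base[OF module_hom_laplacian] laplacian_def[symmetric])
qed

text \<open>The two statements are proved together because \<open>htpy_step\<close> needs both in
  the preceding degree. The homotopy identity is obtained on single pieces and extended by
  additivity; in degree 0 it has no \<open>d\<partial>\<close> term.\<close>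

lemma htpy_invariant:
  shows "x \<in> level L i \<Longrightarrow> v \<in> P x \<Longrightarrow> htpy i v \<in> internal_sum P {y. covers L x y}"
    and "z \<in> carrier L \<Longrightarrow> v \<in> internal_sum P {x \<in> level L i. x \<sqsubseteq>\<^bsub>L\<^esub> z} \<Longrightarrow>
      strip L (part_on (below z) (htpy i v)) =
      (laplacian z \<circ> v) - (if i = 0 then 0 else part_on (below z) (htpy (i - 1) (strip L v)))"
proof (induction i arbitrary: x z v)
  case 0
  {
    case 1
    then show ?case using htpy_0(1) bot by auto
  next
    case (2 z v)
    have "internal_sum P {x \<in> level L 0. x \<sqsubseteq>\<^bsub>L\<^esub> z} \<subseteq> internal_sum P {b}"
      using bot by (intro P_sum_mono[of _ _ 0]) auto
    then have "v \<in> internal_sum P {b}" using 2 by blast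
    then have "v \<in> P b" by (auto simp: internal_sum_def)
    then show ?case by (simp only: htpy_0(2) if_True diff_0_right simp_thms)
  }
next
  case (Suc i)
  {
    case (1 x v)
    show ?case by (rule htpy_step(1)[of i]) (assumption | fact 1 | rule Suc.IH)+
  next
    case (2 z v)
    from 2(2) show ?case
    proof (induction rule: internal_sum_induct)
      case zero
      then show ?case by (simp only: ht.zero pt.zero st.zero lp.zero if_False nat.simps diff_0_right diff_Suc_1)
    next
      case (add v w)
      then show ?case
        by (simp only: ht.add pt.add st.add lp.add if_False nat.simps diff_Suc_1 add_diff_add)
    next
      case (piece x w)
      have "strip L (part_on (below z) (htpy (Suc i) w)) =
          (laplacian z \<circ> w) - part_on (below z) (htpy i (strip L w))"
        by (rule htpy_step(2)[of i x]) (assumption | use piece 2(1) in force | rule Suc.IH)+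
      then show ?case by (simp del: htpy.simps)
    qed
  }
qed


section \<open>Passage to lower intervals and the contracting homotopies\<close>

lemma poset_rank_lower_interval:
  assumes "x \<in> carrier L" "z \<in> carrier L" "x \<sqsubseteq>\<^bsub>L\<^esub> z"
  shows "poset_rank (lower_interval L z) x = poset_rank L x"
proof -
  have "{y \<in> carrier (lower_interval L z). y \<sqsubset>\<^bsub>lower_interval L z\<^esub> x} = {y \<in> carrier L. y \<sqsubset>\<^bsub>L\<^esub> x}"
    using assms le_trans[of _ x z] by (auto simp: lower_interval_def lless_def)
  then show ?thesis unfolding poset_rank_def by (simp add: lower_interval_def)
qed

lemma level_lower_interval:
  "z \<in> carrier L \<Longrightarrow> level (lower_interval L z) i = {x \<in> level L i. x \<sqsubseteq>\<^bsub>L\<^esub> z}"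
  using poset_rank_lower_interval by (auto simp: level_def) (auto simp: lower_interval_def)

lemma covers_lower_interval:
  "z \<in> carrier L \<Longrightarrow> covers (lower_interval L z) y x \<longleftrightarrow> covers L y x \<and> x \<sqsubseteq>\<^bsub>L\<^esub> z"
  using le_trans[of _ x z] by (auto simp: covers_def lower_interval_def lless_def)

text \<open>The homotopy is \<open>d\<close> composed with \<open>A\<close> and truncated below
  \<open>z\<close>. An inverse of \<open>\<Delta>\<^sub>z\<close> on the \<open>U a\<close>
  suffices, as the pieces of positive rank are built from them; acting on coefficients,
  \<open>A\<close> commutes with the boundary.\<close>

theorem contractible:
  assumes inverse: "\<And>z. z \<in> carrier L \<Longrightarrow> \<exists>A. module_hom s s A \<and>
    (\<forall>a \<in> level L 1. a \<sqsubseteq>\<^bsub>L\<^esub> z \<longrightarrow> (\<forall>u \<in> U a. A u \<in> U a \<and> laplacian z (A u) = u))"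
  shows "contractible_over L (minimal_complex s L U0 U)"
  unfolding contractible_over_def
proof (intro conjI compatible ballI)
  fix z assume z: "z \<in> carrier L"
  obtain A where A: "module_hom s s A"
      "\<And>a u. a \<in> level L 1 \<Longrightarrow> a \<sqsubseteq>\<^bsub>L\<^esub> z \<Longrightarrow> u \<in> U a \<Longrightarrow> A u \<in> U a"
      "\<And>a u. a \<in> level L 1 \<Longrightarrow> a \<sqsubseteq>\<^bsub>L\<^esub> z \<Longrightarrow> u \<in> U a \<Longrightarrow> laplacian z (A u) = u"
    using inverse[OF z] by blast
  interpret A: module_hom "fun_scale s" "fun_scale s" "(\<circ>) A" by (rule module_hom_comp_left[OF A(1)])
  let ?h = "\<lambda>i v. part_on (below z) (htpy i (A \<circ> v))"
  let ?I = "\<lambda>i. {x \<in> level L i. x \<sqsubseteq>\<^bsub>L\<^esub> z}"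
  have I: "?I i \<subseteq> level L i" for i by auto
  have sub: "module.subspace (fun_scale s) (internal_sum P (?I i))" for i
    by (rule P_sum_subspace[OF I])
  have deg: "degree_part (lower_interval L z) (minimal_complex s L U0 U) i = internal_sum P (?I i)" for i
    by (simp add: degree_part_def level_lower_interval z)
  have A_deg: "A \<circ> v \<in> internal_sum P (?I (Suc i))" if "v \<in> internal_sum P (?I (Suc i))" for i v
    using that
  proof (induction rule: internal_sum_induct)
    case (piece x u)
    then have "A \<circ> u \<in> P x" by (intro comp_P[OF A(1,2) z]) auto
    with piece(1) show ?case by (rule P_in_sum[OF _ I])
  qed (simp_all only: A.zero A.add F.subspace_0[OF sub] F.subspace_add[OF sub])
  have lap_A: "laplacian z \<circ> (A \<circ> v) = v" if "v \<in> internal_sum P (?I (Suc i))" for i v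
    using that
  proof (induction rule: internal_sum_induct)
    case (piece x u)
    then have "(laplacian z \<circ> A) \<circ> u = u"
      by (intro comp_P_id[OF module_hom_compose[OF A(1) module_hom_laplacian] _ z]) (auto simp: A(3))
    then show ?case by (simp only: comp_assoc)
  qed (simp_all only: A.zero A.add lp.zero lp.add)
  have strip_deg: "strip L v \<in> internal_sum P (?I i)" if "v \<in> internal_sum P (?I (Suc i))" for i v
    using that
  proof (induction rule: internal_sum_induct)
    case (piece x u)
    then have "{y. covers L y x} \<subseteq> ?I i"
      using covers_below[of x i] le_trans[of _ x z] z by (auto simp: covers_def lless_eq)
    then show ?case using strip_P[of x i u] P_sum_mono[OF _ I] piece by blast
  qed (simp_all only: st.zero st.add F.subspace_0[OF sub] F.subspace_add[OF sub])
  have htpy_deg: "part_on (below z) (htpy i v) \<in> internal_sum P (?I (Suc i))"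
    if "v \<in> internal_sum P (?I i)" for i v
    using that
  proof (induction rule: internal_sum_induct)
    case (piece x u)
    then have "htpy i u \<in> internal_sum P {y. covers L x y}" by (intro htpy_invariant(1)) auto
    moreover have "{y. covers L x y} \<inter> below z \<subseteq> ?I (Suc i)" using piece covers_above[of x i] by auto
    ultimately show ?case
      using part_on_P_sum[OF _ covers_above[of x i]] P_sum_mono[OF _ I] piece by blast
  qed (simp_all only: ht.zero ht.add pt.zero pt.add F.subspace_0[OF sub] F.subspace_add[OF sub])
  have scl_eq: "scl (minimal_complex s L U0 U) = fun_scale s"
    and [simp]: "bd (minimal_complex s L U0 U) i = strip L" for i
    by (auto simp: minimal_complex_def)
  have hom: "hom_on (scl (minimal_complex s L U0 U)) S (?h i)" for S i
    by (simp only: hom_on_def scl_eq A.add A.scale ht.add ht.scale pt.add pt.scale) simp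
  have comm: "?h i (strip L v) = part_on (below z) (htpy i (strip L (A \<circ> v)))" for i v
    by (simp only: strip_comp[OF A(1)])
  show "\<exists>d. is_homotopy (lower_interval L z) (minimal_complex s L U0 U) d"
  proof (rule exI[of _ ?h], unfold is_homotopy_def Let_def deg, intro conjI ballI impI)
    show "?h 0 ` bd (minimal_complex s L U0 U) 1 ` internal_sum P (?I 1) \<subseteq> internal_sum P (?I 1)"
    proof (intro image_subsetI, clarsimp simp del: htpy.simps)
      \<comment> \<open>\<open>A\<close> is only known to preserve the \<open>U a\<close>, not
        \<open>U0\<close>. It is therefore applied in degree 1, before the boundary is
        taken.\<close>
      fix v assume "v \<in> internal_sum P (?I (Suc 0))"
      then show "?h 0 (strip L v) \<in> internal_sum P (?I (Suc 0))"
        unfolding comm by (intro htpy_deg strip_deg A_deg)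
    qed
  next
    fix i v assume i: "i \<in> {1..Max (poset_rank (lower_interval L z) ` carrier (lower_interval L z))}"
      and v: "v \<in> internal_sum P (?I i)"
    obtain j where j: "i = Suc j" using i by (cases i) auto
    have "strip L (?h i v) = (laplacian z \<circ> (A \<circ> v)) - ?h j (strip L v)"
      using htpy_invariant(2)[OF z, of "A \<circ> v" i] A_deg[of v j] v j
      by (simp only: comm if_False nat.simps diff_Suc_1 simp_thms)
    then show "?h (i - 1) (bd (minimal_complex s L U0 U) i v) + bd (minimal_complex s L U0 U) (Suc i) (?h i v) = v"
      using lap_A[of v j] v j by simp
  next
    fix i assume "i \<in> {1..Max (poset_rank (lower_interval L z) ` carrier (lower_interval L z))}"
    then obtain j where j: "i = Suc j" by (cases i) auto
    then show "?h i ` internal_sum P (?I i) \<subseteq> internal_sum P (?I (Suc i))"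
      using htpy_deg A_deg by blast
  next
    fix x assume x: "x \<in> carrier (lower_interval L z)" "0 < poset_rank (lower_interval L z) x"
    then have x': "x \<in> carrier L" "x \<sqsubseteq>\<^bsub>L\<^esub> z" by (auto simp: lower_interval_def)
    then obtain i where i: "poset_rank (lower_interval L z) x = Suc i" "x \<in> level L (Suc i)"
      using x(2) poset_rank_lower_interval[OF x'(1) z x'(2)] unfolding level_def
      by (cases "poset_rank L x") auto
    have cov: "{y. covers (lower_interval L z) x y} = {y. covers L x y} \<inter> below z"
      using z by (auto simp: covers_lower_interval)
    show "?h (poset_rank (lower_interval L z) x) ` P x \<subseteq>
        internal_sum P {y. covers (lower_interval L z) x y}"
      unfolding i(1) cov
      by (intro image_subsetI part_on_P_sum[OF _ covers_above[OF i(2)]] htpy_invariant(1)[OF i(2)]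
          comp_P[OF A(1,2) z i(2) x'(2)])
  qed (simp_all only: hom)
qed

end

section \<open>Intersection lattices\<close>

locale hyperplane_arrangement = finite_dimensional_vector_space scale Basis
  for scale :: "'k::field \<Rightarrow> 'v::ab_group_add \<Rightarrow> 'v" and Basis :: "'v set" +
  fixes E :: "'v set" and \<B> :: "'v set set"
  assumes E: "subspace E" and finite_arr: "finite \<B>"
    and hyperplanes: "\<And>H. H \<in> \<B> \<Longrightarrow> hyperplane_of scale E H"
begin

section \<open>Lattice elements as subspaces\<close>

abbreviation "L \<equiv> intersection_lattice E \<B>"

text \<open>The sum of \<open>y\<close> and \<open>H\<close> properly contains the hyperplane
  \<open>H\<close>, so it is all of \<open>E\<close>; the dimension formula for sums then
  applies.\<close>

lemma hyperplane_Int: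
  assumes "subspace y" "y \<subseteq> E" "H \<in> \<B>" "\<not> y \<subseteq> H"
  shows "dim y = Suc (dim (y \<inter> H))"
proof -
  have H: "subspace H" "H \<subseteq> E" "dim E = Suc (dim H)"
    using hyperplanes[OF assms(3)] by (auto simp: hyperplane_of_def)
  let ?S = "{a + b |a b. a \<in> y \<and> b \<in> H}"
  have S: "subspace ?S" using subspace_sums[OF assms(1) H(1)] .
  have "y \<subseteq> ?S"
  proof
    fix a assume "a \<in> y"
    then show "a \<in> ?S" using subspace_0[OF H(1)] by (intro CollectI exI[of _ a] exI[of _ 0]) auto
  qed
  have "H \<subseteq> ?S"
  proof
    fix a assume "a \<in> H"
    then show "a \<in> ?S" using subspace_0[OF assms(1)] by (intro CollectI exI[of _ 0] exI[of _ a]) auto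
  qed
  have "?S \<subseteq> E" using assms(2) H(2) subspace_add[OF E] by auto
  then have "dim ?S \<le> dim E" by (rule dim_subset)
  moreover have "dim H < dim ?S"
  proof (rule ccontr)
    assume "\<not> dim H < dim ?S"
    then have "H = ?S" using subspace_dim_equal[OF H(1) S \<open>H \<subseteq> ?S\<close>] by simp
    then show False using \<open>y \<subseteq> ?S\<close> assms(4) by simp
  qed
  ultimately have "dim ?S = dim E" using H(3) by simp
  then show ?thesis using dim_sums_Int[OF assms(1) H(1)] H(3) by simp
qed

lemma carrier_subspace: "y \<in> carrier L \<Longrightarrow> subspace y"
  using subspace_inter[OF E subspace_Inter] hyperplanes
  by (auto simp: intersection_lattice_def hyperplane_of_def)

lemma carrier_subset: "y \<in> carrier L \<Longrightarrow> y \<subseteq> E"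
  by (auto simp: intersection_lattice_def)

lemma carrier_E: "E \<in> carrier L"
  by (auto simp: intersection_lattice_def intro: exI[of _ "{}"])

lemma carrier_Int_hyperplane: "y \<in> carrier L \<Longrightarrow> H \<in> \<B> \<Longrightarrow> y \<inter> H \<in> carrier L"
proof -
  assume *: "y \<in> carrier L" "H \<in> \<B>"
  then obtain S where "S \<subseteq> \<B>" "y = E \<inter> \<Inter>S" by (auto simp: intersection_lattice_def)
  then show ?thesis using *(2)
    by (auto simp: intersection_lattice_def intro!: exI[of _ "insert H S"])
qed

lemma arr_carrier: "H \<in> \<B> \<Longrightarrow> H \<in> carrier L"
  using carrier_Int_hyperplane[OF carrier_E, of H] hyperplanes[of H]
  by (auto simp: hyperplane_of_def Int_absorb1)

lemma finite_carrier: "finite (carrier L)"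
proof -
  have "carrier L = (\<lambda>S. E \<inter> \<Inter>S) ` Pow \<B>" by (auto simp: intersection_lattice_def)
  then show ?thesis using finite_arr by simp
qed

lemma le_L [simp]: "y \<sqsubseteq>\<^bsub>L\<^esub> z \<longleftrightarrow> z \<subseteq> y"
  by (simp add: intersection_lattice_def)

lemma lless_L [simp]: "y \<sqsubset>\<^bsub>L\<^esub> z \<longleftrightarrow> z \<subset> y"
  by (auto simp: lless_def intersection_lattice_def)

lemma partial_order_L: "partial_order L"
  by unfold_locales (auto simp: intersection_lattice_def)

lemma dim_less: "y \<in> carrier L \<Longrightarrow> z \<in> carrier L \<Longrightarrow> y \<subset> z \<Longrightarrow> dim y < dim z"
  using dim_psubset[of y z] carrier_subspace span_eq_iff by metis

section \<open>Covering relations, rank and semimodularity\<close>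

lemma step_down:
  assumes "y \<in> carrier L" "z \<in> carrier L" "z \<subset> y"
  obtains H where "H \<in> \<B>" "z \<subseteq> H" "\<not> y \<subseteq> H"
proof -
  obtain S where S: "S \<subseteq> \<B>" "z = E \<inter> \<Inter>S" using assms by (auto simp: intersection_lattice_def)
  have "\<exists>H\<in>S. \<not> y \<subseteq> H"
  proof (rule ccontr)
    assume "\<not> ?thesis"
    then have "y \<subseteq> z" using S(2) carrier_subset[OF assms(1)] by auto
    then show False using assms(3) by auto
  qed
  then show ?thesis using that S by blast
qed

text \<open>Cutting with \<open>H\<close> lowers the dimension by only one, which leaves no room for
  a lattice element strictly in between.\<close>

lemma covers_Int:
  assumes "y \<in> carrier L" "H \<in> \<B>" "\<not> y \<subseteq> H"
  shows "covers L y (y \<inter> H)"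
proof -
  have d: "dim y = Suc (dim (y \<inter> H))"
    using assms carrier_subspace carrier_subset by (intro hyperplane_Int) auto
  have c: "y \<inter> H \<in> carrier L" using assms by (intro carrier_Int_hyperplane)
  have "\<not> (y \<inter> H \<subset> z \<and> z \<subset> y)" if "z \<in> carrier L" for z
    using dim_less[OF c that] dim_less[OF that assms(1)] d by linarith
  then show ?thesis using assms c by (auto simp: covers_def)
qed

text \<open>A hyperplane that contains \<open>x\<close> but not \<open>y\<close> cuts
  \<open>y\<close> down to a smaller lattice element containing \<open>x\<close>, which must then be
  \<open>x\<close>.\<close>

lemma coversE:
  assumes "covers L y x"
  obtains H where "H \<in> \<B>" "\<not> y \<subseteq> H" "x = y \<inter> H"
proof -
  have *: "y \<in> carrier L" "x \<in> carrier L" "x \<subset> y" using assms by (auto simp: covers_def)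
  obtain H where H: "H \<in> \<B>" "x \<subseteq> H" "\<not> y \<subseteq> H" using step_down[OF *] .
  have "\<not> x \<subset> y \<inter> H"
    using assms H carrier_Int_hyperplane[OF *(1) H(1)] by (auto simp: covers_def)
  then have "x = y \<inter> H" using H * by auto
  then show ?thesis using that H by blast
qed

lemma covers_dim:
  assumes "covers L y x"
  shows "dim y = Suc (dim x)"
proof -
  obtain H where H: "H \<in> \<B>" "\<not> y \<subseteq> H" "x = y \<inter> H" using coversE[OF assms] .
  then show ?thesis
    using hyperplane_Int[of y H] carrier_subspace carrier_subset assms by (auto simp: covers_def)
qed

text \<open>Cutting with one hyperplane at a time leads from \<open>y\<close> to \<open>x\<close> in
  \<open>dim y - dim x\<close> steps. The chain may contain \<open>y\<close> but not
  \<open>x\<close>, to match the chains counted by \<open>poset_rank\<close>.\<close>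

lemma chain_exists:
  assumes "x \<in> carrier L" "y \<in> carrier L" "x \<subseteq> y"
  shows "\<exists>K \<subseteq> {z \<in> carrier L. x \<subset> z \<and> z \<subseteq> y}. (\<forall>z\<in>K. \<forall>w\<in>K. w \<subseteq> z \<or> z \<subseteq> w) \<and> card K = dim y - dim x"
  using assms
proof (induction "dim y - dim x" arbitrary: y)
  case 0
  then show ?case by (intro exI[of _ "{}"]) auto
next
  case (Suc n)
  then have "x \<subset> y" by auto
  obtain H where H: "H \<in> \<B>" "x \<subseteq> H" "\<not> y \<subseteq> H"
    using step_down[OF Suc.prems(2,1) \<open>x \<subset> y\<close>] .
  have d: "dim y = Suc (dim (y \<inter> H))"
    using Suc.prems H carrier_subspace carrier_subset by (intro hyperplane_Int) auto
  have c: "y \<inter> H \<in> carrier L" using Suc.prems H by (intro carrier_Int_hyperplane)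
  obtain K where K: "K \<subseteq> {z \<in> carrier L. x \<subset> z \<and> z \<subseteq> y \<inter> H}"
      "\<forall>z\<in>K. \<forall>w\<in>K. w \<subseteq> z \<or> z \<subseteq> w" "card K = dim (y \<inter> H) - dim x"
  proof -
    have "n = dim (y \<inter> H) - dim x" "x \<subseteq> y \<inter> H" using Suc.hyps(2) Suc.prems H d by auto
    from Suc.hyps(1)[OF this(1) Suc.prems(1) c this(2)] that show ?thesis by blast
  qed
  have "finite K" using K(1) finite_subset[OF _ finite_carrier] by auto
  moreover have "y \<notin> K" using K(1) H(3) by auto
  moreover have "dim x \<le> dim (y \<inter> H)" using Suc.prems H by (intro dim_subset) auto
  ultimately have "card (insert y K) = dim y - dim x" using K(3) d by simp
  moreover have "insert y K \<subseteq> {z \<in> carrier L. x \<subset> z \<and> z \<subseteq> y}"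
    using K(1) Suc.prems \<open>x \<subset> y\<close> by auto
  moreover have "\<forall>z\<in>insert y K. \<forall>w\<in>insert y K. w \<subseteq> z \<or> z \<subseteq> w" using K(1,2) by blast
  ultimately show ?case by blast
qed

text \<open>A chain of this size comes from \<open>chain_exists\<close> with \<open>y = E\<close>.
  No chain is larger, because the dimensions of its members are distinct, exceed
  \<open>dim x\<close> and are at most \<open>dim E\<close>.\<close>

lemma poset_rank_L:
  assumes x: "x \<in> carrier L"
  shows "poset_rank L x = dim E - dim x"
proof -
  let ?K = "{card K | K. K \<subseteq> {y \<in> carrier L. y \<sqsubset>\<^bsub>L\<^esub> x} \<and> (\<forall>y \<in> K. \<forall>z \<in> K. y \<sqsubseteq>\<^bsub>L\<^esub> z \<or> z \<sqsubseteq>\<^bsub>L\<^esub> y)}"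
  have "Max ?K = dim E - dim x"
  proof (rule Max_eqI)
    have "?K \<subseteq> card ` Pow (carrier L)" by blast
    then show "finite ?K" using finite_carrier finite_subset by blast
    obtain K where "K \<subseteq> {z \<in> carrier L. x \<subset> z \<and> z \<subseteq> E}"
      "\<forall>z\<in>K. \<forall>w\<in>K. w \<subseteq> z \<or> z \<subseteq> w" "card K = dim E - dim x"
      using chain_exists[OF x carrier_E carrier_subset[OF x]] by blast
    then show "dim E - dim x \<in> ?K" by (intro CollectI exI[of _ K]) auto
    fix k assume "k \<in> ?K"
    then obtain K where K: "K \<subseteq> {y \<in> carrier L. x \<subset> y}" "\<forall>y \<in> K. \<forall>z \<in> K. z \<subseteq> y \<or> y \<subseteq> z" "k = card K"
      by auto
    have "inj_on dim K"
    proof (rule inj_onI)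
      fix y z assume yz: "y \<in> K" "z \<in> K" "dim y = dim z"
      then have "y \<in> carrier L" "z \<in> carrier L" "z \<subseteq> y \<or> y \<subseteq> z" using K(1,2) by blast+
      then show "y = z" using dim_less[of y z] dim_less[of z y] yz(3) by (auto simp: psubset_eq)
    qed
    moreover have "dim ` K \<subseteq> {dim x <.. dim E}"
    proof (intro image_subsetI)
      fix y assume "y \<in> K"
      then have y: "y \<in> carrier L" "x \<subset> y" using K(1) by blast+
      show "dim y \<in> {dim x <.. dim E}"
        using dim_less[OF x y] dim_subset[OF carrier_subset[OF y(1)]] by simp
    qed
    ultimately show "k \<le> dim E - dim x"
      using K(3) card_inj_on_le[of dim K "{dim x <.. dim E}"] by simp
  qed
  then show ?thesis by (simp add: poset_rank_def)
qed

lemma dim_le: "y \<in> carrier L \<Longrightarrow> dim y \<le> dim E"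
  using carrier_subset dim_subset by blast

lemma graded_L: "covers L y x \<Longrightarrow> poset_rank L x = Suc (poset_rank L y)"
  using covers_dim[of y x] dim_le[of y] by (auto simp: poset_rank_L covers_def)

lemma level_0: "level L 0 = {E}"
proof -
  have "x = E" if "x \<in> carrier L" "dim E \<le> dim x" for x
    using subspace_dim_equal[OF carrier_subspace E carrier_subset] that by auto
  moreover have "x \<in> level L 0 \<longleftrightarrow> x \<in> carrier L \<and> dim E \<le> dim x" for x
    by (auto simp: level_def poset_rank_L)
  ultimately show ?thesis using carrier_E by blast
qed

lemma level_1: "level L 1 = \<B>"
proof (intro equalityI subsetI)
  fix a assume a: "a \<in> level L 1"
  then have a': "a \<in> carrier L" "dim E - dim a = 1" by (auto simp: level_def poset_rank_L)
  then have "a \<subset> E" using carrier_subset by auto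
  obtain H where H: "H \<in> \<B>" "a \<subseteq> H" using step_down[OF carrier_E a'(1) \<open>a \<subset> E\<close>] .
  have "dim E = Suc (dim H)" "subspace H" using hyperplanes[OF H(1)] by (auto simp: hyperplane_of_def)
  then have "a = H" using subspace_dim_equal[OF carrier_subspace[OF a'(1)] _ H(2)] a'(2) by auto
  then show "a \<in> \<B>" using H by simp
next
  fix H assume H: "H \<in> \<B>"
  then show "H \<in> level L 1"
    using arr_carrier[OF H] hyperplanes[OF H] by (auto simp: level_def poset_rank_L hyperplane_of_def)
qed

text \<open>The join of \<open>x\<close> and \<open>x'\<close> is their intersection. Since
  \<open>x' = t \<inter> H\<close>, it equals \<open>x \<inter> H\<close> and so covers
  \<open>x\<close>. A cover of \<open>x\<close> contained in \<open>x'\<close> lies inside this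
  intersection and has the same dimension.\<close>

lemma diamond_L:
  assumes t: "covers L t x'" and x: "t \<sqsubseteq>\<^bsub>L\<^esub> x" "\<not> x' \<sqsubseteq>\<^bsub>L\<^esub> x" "x \<in> carrier L"
    and z: "z \<in> carrier L" "x \<sqsubseteq>\<^bsub>L\<^esub> z" "x' \<sqsubseteq>\<^bsub>L\<^esub> z"
  shows "\<exists>!y. covers L x y \<and> y \<sqsubseteq>\<^bsub>L\<^esub> z \<and> x' \<sqsubseteq>\<^bsub>L\<^esub> y"
proof -
  obtain H where H: "H \<in> \<B>" "\<not> t \<subseteq> H" "x' = t \<inter> H" using coversE[OF t] .
  have eq: "x \<inter> x' = x \<inter> H" using H(3) x(1) by auto
  have "\<not> x \<subseteq> H" using eq x(2) by auto
  then have cov: "covers L x (x \<inter> x')" unfolding eq by (intro covers_Int x(3) H(1))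
  have "y = x \<inter> x'" if y: "covers L x y" "x' \<sqsubseteq>\<^bsub>L\<^esub> y" for y
  proof (rule subspace_dim_equal)
    show "subspace y" "subspace (x \<inter> x')"
      using y cov carrier_subspace by (auto simp: covers_def)
    show "y \<subseteq> x \<inter> x'" using y by (auto simp: covers_def)
    show "dim (x \<inter> x') \<le> dim y" using covers_dim[OF cov] covers_dim[OF y(1)] by simp
  qed
  moreover have "x \<inter> x' \<sqsubseteq>\<^bsub>L\<^esub> z" "x' \<sqsubseteq>\<^bsub>L\<^esub> x \<inter> x'" using z by auto
  ultimately show ?thesis using cov by blast
qed

end

section \<open>Sums over reflections\<close>

context finite_dimensional_vector_space begin

lemma group_GL: "group (GL scale)"
proof (rule groupI)
  fix g assume g: "g \<in> carrier (GL scale)"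
  then have "Vector_Spaces.linear scale scale (inv_into UNIV g)" "bij (inv_into UNIV g)" "inv_into UNIV g \<circ> g = id"
    using inj_linear_imp_inv_linear[of g] by (auto simp: GL_def bij_imp_bij_inv bij_is_inj)
  then show "\<exists>h\<in>carrier (GL scale). h \<otimes>\<^bsub>GL scale\<^esub> g = \<one>\<^bsub>GL scale\<^esub>"
    by (intro bexI[of _ "inv_into UNIV g"]) (auto simp: GL_def)
qed (auto simp: GL_def linear_id comp_assoc bij_comp intro: Vector_Spaces.linear_compose)

end

locale finite_linear_group = finite_dimensional_vector_space scale Basis
  for scale :: "complex \<Rightarrow> 'v::ab_group_add \<Rightarrow> 'v" and Basis :: "'v set" +
  fixes G :: "('v \<Rightarrow> 'v) set"
  assumes subgroup_G: "subgroup G (GL scale)" and finite_G: "finite G"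
begin

section \<open>Finite linear groups and an invariant inner product\<close>

lemma linear_G: "g \<in> G \<Longrightarrow> Vector_Spaces.linear scale scale g"
  and bij_G: "g \<in> G \<Longrightarrow> bij g"
  using subgroup.subset[OF subgroup_G] by (auto simp: GL_def)

lemma comp_G: "g \<in> G \<Longrightarrow> h \<in> G \<Longrightarrow> g \<circ> h \<in> G"
  using subgroup.m_closed[OF subgroup_G] by (simp add: GL_def)

lemma id_G: "id \<in> G"
  using subgroup.one_closed[OF subgroup_G] by (simp add: GL_def)

text \<open>The inverse taken in the group \<open>GL scale\<close> is a left inverse of the
  bijection \<open>g\<close>, hence the inverse function.\<close>

lemma inv_G:
  assumes g: "g \<in> G" shows "inv_into UNIV g \<in> G"
proof -
  interpret GL: group "GL scale" by (rule group_GL)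
  have gc: "g \<in> carrier (GL scale)" using subgroup.subset[OF subgroup_G] g by auto
  have "(inv\<^bsub>GL scale\<^esub> g) \<circ> g = id" using GL.l_inv[OF gc] by (simp add: GL_def)
  then have "inv\<^bsub>GL scale\<^esub> g = inv_into UNIV g"
    using bij_G[OF g] by (metis bij_is_surj comp_assoc comp_id surj_iff id_comp)
  then show ?thesis using subgroup.m_inv_closed[OF subgroup_G g] by simp
qed

lemma add_G: "g \<in> G \<Longrightarrow> g (v + w) = g v + g w"
  and diff_G: "g \<in> G \<Longrightarrow> g (v - w) = g v - g w"
  and zero_G: "g \<in> G \<Longrightarrow> g 0 = 0"
  and scale_G: "g \<in> G \<Longrightarrow> g (scale c v) = scale c (g v)"
  and sum_G: "g \<in> G \<Longrightarrow> g (sum f I) = (\<Sum>i\<in>I. g (f i))"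
  using module_hom.add module_hom.diff module_hom.zero module_hom.scale module_hom.sum
    linear_G[THEN Vector_Spaces.linear.axioms(3)] by metis+

text \<open>The real part of the standard hermitian form in the coordinates of \<open>Basis\<close>,
  summed over \<open>G\<close> to make it invariant. Taking real parts makes it symmetric while
  keeping it positive definite.\<close>

definition herm :: "'v \<Rightarrow> 'v \<Rightarrow> real" where
  "herm v w = (\<Sum>g\<in>G. \<Sum>b\<in>Basis. Re (representation Basis (g v) b * cnj (representation Basis (g w) b)))"

lemma herm_commute: "herm v w = herm w v"
  by (auto simp: herm_def mult.commute intro!: sum.cong)

lemma herm_add_right: "herm v (w + w') = herm v w + herm v w'"
  by (auto simp: herm_def add_G representation_add[OF independent_Basis] span_Basis algebra_simps
      simp flip: sum.distrib intro!: sum.cong)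

lemma herm_diff_right: "herm v (w - w') = herm v w - herm v w'"
  using herm_add_right[of v "w - w'" w'] by simp

lemma herm_zero_right: "herm v 0 = 0"
  using herm_diff_right[of v 0 0] by simp

lemma herm_sum_right: "herm v (sum f I) = (\<Sum>i\<in>I. herm v (f i))"
  by (induction I rule: infinite_finite_induct) (auto simp: herm_zero_right herm_add_right)

lemma herm_self: "herm v v = (\<Sum>g\<in>G. \<Sum>b\<in>Basis. (cmod (representation Basis (g v) b))\<^sup>2)"
  unfolding herm_def by (intro sum.cong refl) (simp only: cmod_power2, simp add: power2_eq_square)

lemma herm_nonneg: "0 \<le> herm v v"
  unfolding herm_self by (intro sum_nonneg) auto

lemma herm_eq_0:
  assumes "herm v v = 0"
  shows "v = 0"
proof -
  have "(\<Sum>b\<in>Basis. (cmod (representation Basis (id v) b))\<^sup>2) = 0"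
    using assms id_G unfolding herm_self
    by (subst (asm) sum_nonneg_eq_0_iff) (auto simp: finite_G intro: sum_nonneg)
  then have "representation Basis v b = 0" if "b \<in> Basis" for b
    using that by (subst (asm) sum_nonneg_eq_0_iff) (auto simp: finite_Basis)
  then have "(\<Sum>b\<in>Basis. scale (representation Basis v b) b) = 0" by simp
  then show ?thesis
    using sum_representation_eq[OF independent_Basis _ finite_Basis order_refl, of v] by (simp add: span_Basis)
qed

text \<open>Right multiplication by \<open>h\<close> permutes the group over which the form is
  summed.\<close>

lemma herm_invariant:
  assumes h: "h \<in> G"
  shows "herm (h v) (h w) = herm v w"
proof -
  have "bij_betw (\<lambda>g. g \<circ> h) G G"
  proof (rule bij_betw_byWitness[where f' = "\<lambda>g. g \<circ> inv_into UNIV h"])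
    have "inv_into UNIV h \<circ> h = id" "h \<circ> inv_into UNIV h = id"
      using bij_G[OF h] by (simp_all add: bij_is_inj bij_is_surj surj_iff[symmetric])
    then show "\<forall>g\<in>G. (g \<circ> h) \<circ> inv_into UNIV h = g" "\<forall>g\<in>G. (g \<circ> inv_into UNIV h) \<circ> h = g"
      by (auto simp: comp_assoc)
    show "(\<lambda>g. g \<circ> h) ` G \<subseteq> G" "(\<lambda>g. g \<circ> inv_into UNIV h) ` G \<subseteq> G"
      using comp_G h inv_G by auto
  qed
  from sum.reindex_bij_betw[OF this, of "\<lambda>g. \<Sum>b\<in>Basis. Re (representation Basis (g v) b * cnj (representation Basis (g w) b))"]
  show ?thesis by (simp add: herm_def)
qed

text \<open>For an isometry \<open>h\<close>, pairing \<open>v - h v\<close> with itself gives twice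
  its pairing with \<open>v\<close>. Summed over \<open>R\<close> the latter is 0, so each of the
  nonnegative squares vanishes.\<close>

lemma fixed_if_sum_zero:
  assumes R: "R \<subseteq> G" and sum: "(\<Sum>g\<in>R. v - g v) = 0" and g: "g \<in> R"
  shows "g v = v"
proof -
  have pos: "herm (v - h v) (v - h v) = 2 * herm v (v - h v)" if "h \<in> R" for h
    using herm_invariant[of h v v] that R herm_diff_right[of v v "h v"]
      herm_diff_right[of "v - h v" v "h v"] herm_diff_right[of "h v" v "h v"]
      herm_commute[of "v - h v" v] herm_commute[of "v - h v" "h v"] herm_commute[of "h v" v]
    by auto
  have "(\<Sum>h\<in>R. herm (v - h v) (v - h v)) = (\<Sum>h\<in>R. 2 * herm v (v - h v))"
    using pos by simp
  also have "\<dots> = 2 * herm v (\<Sum>h\<in>R. v - h v)"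
    by (simp add: herm_sum_right sum_distrib_left)
  also have "\<dots> = 0" by (simp add: sum herm_zero_right)
  finally have "herm (v - g v) (v - g v) = 0"
    using R finite_G finite_subset g by (subst (asm) sum_nonneg_eq_0_iff) (auto intro: herm_nonneg)
  then show ?thesis using herm_eq_0[of "v - g v"] by simp
qed

section \<open>Reflections fixing a lattice element and the operators
  \<open>N\<^sub>z\<close>\<close>

definition refls :: "'v set \<Rightarrow> ('v \<Rightarrow> 'v) set" where
  "refls z = {g \<in> G. (\<exists>H. reflection_in scale H g) \<and> (\<forall>v\<in>z. g v = v)}"

definition refl_sum :: "'v set \<Rightarrow> 'v \<Rightarrow> 'v" where
  "refl_sum z v = (\<Sum>g\<in>refls z. v - g v)"

abbreviation "arr \<equiv> reflection_arrangement scale G"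
abbreviation "Lat \<equiv> intersection_lattice UNIV arr"

lemma refls_subset: "refls z \<subseteq> G"
  by (auto simp: refls_def)

lemma finite_refls: "finite (refls z)"
  using refls_subset finite_G finite_subset by blast

lemma refls_antimono: "z \<subseteq> z' \<Longrightarrow> refls z' \<subseteq> refls z"
  by (auto simp: refls_def)

lemma subspace_fixed: "g \<in> G \<Longrightarrow> subspace {v. g v = v}"
  by (auto simp: subspace_def add_G scale_G zero_G)

text \<open>The fixed space contains the hyperplane \<open>H\<close> and is not everything, as
  \<open>g\<close> is not the identity; dimensions leave only \<open>H\<close>.\<close>

lemma reflection_fixed:
  assumes "g \<in> G" "reflection_in scale H g"
  shows "{v. g v = v} = H"
proof (rule ccontr)
  assume ne: "{v. g v = v} \<noteq> H"
  have H: "subspace H" "dim UNIV = Suc (dim H)" "H \<subseteq> {v. g v = v}" "g \<noteq> id"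
    using assms(2) by (auto simp: reflection_in_def hyperplane_of_def)
  note sub = subspace_fixed[OF assms(1)]
  have "\<not> dim {v. g v = v} \<le> dim H"
    using subspace_dim_equal[OF H(1) sub H(3)] ne by auto
  then have "{v. g v = v} = UNIV"
    using H(2) by (intro subspace_dim_equal[OF sub]) auto
  then have "g = id" by (auto simp: fun_eq_iff)
  then show False using H(4) by simp
qed

lemma arr_hyperplane: "H \<in> arr \<Longrightarrow> hyperplane_of scale UNIV H"
  by (auto simp: reflection_arrangement_def reflection_in_def)

lemma finite_arr: "finite arr"
proof -
  have "arr \<subseteq> (\<lambda>g. {v. g v = v}) ` G"
    using reflection_fixed by (auto simp: reflection_arrangement_def)
  then show ?thesis using finite_G finite_surj by blast
qed

text \<open>\<open>z\<close> is an intersection of hyperplanes, each of which is the fixed space of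
  a reflection that fixes \<open>z\<close> pointwise.\<close>

lemma lat_fixed:
  assumes z: "z \<in> carrier Lat"
  shows "z = {v. \<forall>g\<in>refls z. g v = v}"
proof (intro equalityI subsetI)
  fix v assume v: "v \<in> {v. \<forall>g\<in>refls z. g v = v}"
  obtain S where S: "S \<subseteq> arr" "z = \<Inter>S" using z by (auto simp: intersection_lattice_def)
  have "v \<in> H" if H: "H \<in> S" for H
  proof -
    obtain g where g: "g \<in> G" "reflection_in scale H g"
      using H S(1) by (auto simp: reflection_arrangement_def)
    have "g \<in> refls z" using g reflection_fixed[OF g] H S(2) by (auto simp: refls_def)
    then show ?thesis using v reflection_fixed[OF g] by auto
  qed
  then show "v \<in> z" using S(2) by auto
qed (auto simp: refls_def)

text \<open>Conjugation by \<open>h\<close> turns a reflection in \<open>H\<close> into a reflection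
  in the image of \<open>H\<close> under \<open>h\<close>.\<close>

lemma refls_conj:
  assumes "g \<in> refls z" "h \<in> G" "h ` z \<subseteq> z" "inv_into UNIV h ` z \<subseteq> z"
  shows "h \<circ> g \<circ> inv_into UNIV h \<in> refls z"
proof -
  have g: "g \<in> G" using assms(1) by (auto simp: refls_def)
  obtain H where H: "reflection_in scale H g" using assms(1) by (auto simp: refls_def)
  have hi: "inv_into UNIV h (h v) = v" "h (inv_into UNIV h v) = v" for v
    using bij_G[OF assms(2)] by (auto simp: bij_is_inj bij_is_surj surj_f_inv_f)
  let ?k = "h \<circ> g \<circ> inv_into UNIV h"
  have k: "?k \<in> G" by (intro comp_G inv_G assms(2) g)
  interpret h: Vector_Spaces.linear scale scale h by (rule linear_G[OF assms(2)])
  interpret pair: finite_dimensional_vector_space_pair_1 scale Basis scale by unfold_locales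
  have sub: "subspace (h ` H)"
    using H by (intro h.subspace_image) (auto simp: reflection_in_def hyperplane_of_def)
  have "inj h" using bij_G[OF assms(2)] by (rule bij_is_inj)
  then have "dim (h ` H) = dim H"
    by (intro pair.dim_image_eq linear_G assms(2)) (rule inj_on_subset[OF _ subset_UNIV])
  then have hyp: "hyperplane_of scale UNIV (h ` H)"
    using H sub by (auto simp: reflection_in_def hyperplane_of_def)
  have "?k \<noteq> id"
  proof
    assume id: "?k = id"
    have "g v = v" for v
      using fun_cong[OF id, of "h v"] hi \<open>inj h\<close> by (auto dest: injD)
    then show False using H by (auto simp: reflection_in_def fun_eq_iff)
  qed
  moreover have "\<forall>v\<in>h ` H. ?k v = v" using H hi by (auto simp: reflection_in_def)
  ultimately have "reflection_in scale (h ` H) ?k"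
    using hyp k subgroup.subset[OF subgroup_G] by (auto simp: reflection_in_def)
  moreover have "\<forall>v\<in>z. ?k v = v"
  proof
    fix v assume "v \<in> z"
    then have "inv_into UNIV h v \<in> z" using assms(4) by auto
    then have "g (inv_into UNIV h v) = inv_into UNIV h v" using assms(1) by (auto simp: refls_def)
    then show "?k v = v" using hi by simp
  qed
  ultimately show ?thesis using k by (auto simp: refls_def)
qed

text \<open>Both \<open>h\<close> and its inverse fix \<open>z\<close> pointwise, so conjugation by
  \<open>h\<close> permutes the reflections in the sum.\<close>

lemma refl_sum_commute:
  assumes h: "h \<in> refls z"
  shows "h (refl_sum z v) = refl_sum z (h v)"
proof -
  have hG: "h \<in> G" using h refls_subset by auto
  have fixh: "h v = v" if "v \<in> z" for v using h that by (auto simp: refls_def)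
  have hi: "inv_into UNIV h (h v) = v" "h (inv_into UNIV h v) = v" for v
    using bij_G[OF hG] by (auto simp: bij_is_inj bij_is_surj surj_f_inv_f)
  have fixi: "inv_into UNIV h v = v" if "v \<in> z" for v using fixh[OF that] hi(1)[of v] by simp
  have ii: "inv_into UNIV (inv_into UNIV h) = h" using bij_G[OF hG] by (rule inv_inv_eq)
  let ?c = "\<lambda>g. h \<circ> g \<circ> inv_into UNIV h"
  have "bij_betw ?c (refls z) (refls z)"
  proof (rule bij_betw_byWitness[where f' = "\<lambda>g. inv_into UNIV h \<circ> g \<circ> h"])
    show "?c ` refls z \<subseteq> refls z"
      using refls_conj[OF _ hG] fixh fixi by auto
    show "(\<lambda>g. inv_into UNIV h \<circ> g \<circ> h) ` refls z \<subseteq> refls z"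
      using refls_conj[OF _ inv_G[OF hG], of _ z] fixh fixi unfolding ii by auto
  qed (auto simp: fun_eq_iff hi)
  then have "refl_sum z (h v) = (\<Sum>g\<in>refls z. h v - ?c g (h v))"
    unfolding refl_sum_def by (rule sum.reindex_bij_betw[symmetric])
  also have "\<dots> = (\<Sum>g\<in>refls z. h (v - g v))" by (simp add: hi diff_G[OF hG])
  also have "\<dots> = h (refl_sum z v)" by (simp add: refl_sum_def sum_G[OF hG])
  finally show ?thesis by simp
qed

text \<open>\<open>z'\<close> is the common fixed space of \<open>refls z'\<close>. These
  reflections belong to \<open>refls z\<close>, so they commute with
  \<open>refl_sum z\<close>.\<close>

lemma refl_sum_preserves:
  assumes "z' \<in> carrier Lat" "z \<subseteq> z'" "v \<in> z'"
  shows "refl_sum z v \<in> z'"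
proof -
  have "h (refl_sum z v) = refl_sum z v" if h: "h \<in> refls z'" for h
    using refl_sum_commute[of h z v] refls_antimono[OF assms(2)] h assms(3) by (auto simp: refls_def)
  then show ?thesis using lat_fixed[OF assms(1)] by blast
qed

lemma refl_sum_zero: "v \<in> z \<Longrightarrow> refl_sum z v = 0"
  by (auto simp: refl_sum_def refls_def intro: sum.neutral)

lemma refl_sum_eq_0:
  assumes "z \<in> carrier Lat" "refl_sum z v = 0"
  shows "v \<in> z"
  using fixed_if_sum_zero[OF refls_subset] assms lat_fixed[OF assms(1)] unfolding refl_sum_def by blast

lemma linear_refl_sum: "Vector_Spaces.linear scale scale (refl_sum z)"
proof -
  interpret vector_space_pair scale scale by unfold_locales
  show ?thesis unfolding refl_sum_def
    by (intro linear_compose_sum ballI linear_compose_sub linear_ident linear_G)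
      (use refls_subset in auto)
qed

text \<open>\<open>S\<close> inverts \<open>refl_sum z\<close> modulo \<open>z\<close>, which is
  what is wanted for functionals vanishing on \<open>z\<close>.\<close>

lemma refl_sum_inverse:
  assumes z: "z \<in> carrier Lat"
  obtains S where "Vector_Spaces.linear scale scale S"
    "\<And>z' v. z' \<in> carrier Lat \<Longrightarrow> z \<subseteq> z' \<Longrightarrow> v \<in> z' \<Longrightarrow> S v \<in> z'"
    "\<And>v. v - S (refl_sum z v) \<in> z"
proof -
  interpret pair: finite_dimensional_vector_space_pair_1 scale Basis scale by unfold_locales
  \<comment> \<open>\<open>W\<close> is the pointwise stabiliser of \<open>z\<close>, and
    \<open>Q\<close> is \<open>card W\<close> times a projection onto \<open>z\<close> that kills
    the image of \<open>refl_sum z\<close>.\<close>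
  define W where "W = {g \<in> G. \<forall>v\<in>z. g v = v}"
  define Q where "Q v = (\<Sum>g\<in>W. g v)" for v
  define T where "T v = refl_sum z v + Q v" for v
  have W: "W \<subseteq> G" "finite W" "id \<in> W" using finite_G id_G by (auto simp: W_def)
  have linQ: "Vector_Spaces.linear scale scale Q" unfolding Q_def
    by (intro pair.linear_compose_sum ballI linear_G) (use W in auto)
  have linT: "Vector_Spaces.linear scale scale T" unfolding T_def
    by (intro pair.linear_compose_add linear_refl_sum linQ)
  interpret Q: Vector_Spaces.linear scale scale Q by (rule linQ)
  interpret T: Vector_Spaces.linear scale scale T by (rule linT)
  have refls_W: "refls z \<subseteq> W" by (auto simp: refls_def W_def)
  have shift: "bij_betw (\<lambda>g. h \<circ> g) W W" "bij_betw (\<lambda>g. g \<circ> h) W W" if h: "h \<in> W" for h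
  proof -
    have bij: "bij h" using h W(1) bij_G by auto
    have "inj_on (\<lambda>g. h \<circ> g) W"
      using bij_is_inj[OF bij] by (auto intro!: inj_onI simp: fun_eq_iff inj_eq)
    moreover have "inj_on (\<lambda>g. g \<circ> h) W"
      using bij_is_surj[OF bij] by (auto intro!: inj_onI simp: fun_eq_iff) (metis surjD)
    moreover have "(\<lambda>g. h \<circ> g) ` W \<subseteq> W" "(\<lambda>g. g \<circ> h) ` W \<subseteq> W"
      using h comp_G by (auto simp: W_def)
    ultimately show "bij_betw (\<lambda>g. h \<circ> g) W W" "bij_betw (\<lambda>g. g \<circ> h) W W"
      using endo_inj_surj[OF W(2)] by (auto simp: bij_betw_def)
  qed
  have hQ: "h (Q v) = Q v" if h: "h \<in> W" for h v
    using sum.reindex_bij_betw[OF shift(1)[OF h], of "\<lambda>g. g v"] h W(1)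
    by (auto simp: Q_def sum_G)
  have Qh: "Q (h v) = Q v" if h: "h \<in> W" for h v
    using sum.reindex_bij_betw[OF shift(2)[OF h], of "\<lambda>g. g v"] by (auto simp: Q_def)
  have Q_z: "Q v \<in> z" for v
    using hQ refls_W lat_fixed[OF z] by blast
  have Q_on_z: "Q v = scale (of_nat (card W)) v" if "v \<in> z" for v
  proof -
    have "Q v = (\<Sum>g\<in>W. v)" unfolding Q_def using that by (intro sum.cong) (auto simp: W_def)
    then show ?thesis by (simp add: sum_constant_scale)
  qed
  have card: "of_nat (card W) \<noteq> (0::complex)" using W by auto
  have QN: "Q (refl_sum z v) = 0" for v
    unfolding refl_sum_def Q.sum Q.diff using Qh refls_W by (intro sum.neutral) auto
  have "inj T"
  proof (subst T.inj_iff_eq_0, intro allI impI)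
    fix v assume v: "T v = 0"
    \<comment> \<open>Applying \<open>Q\<close> to \<open>T v = 0\<close> removes the first summand
      of \<open>T v\<close> and isolates \<open>Q v\<close>.\<close>
    have "Q (T v) = scale (of_nat (card W)) (Q v)"
      by (simp add: T_def Q.add QN Q_on_z[OF Q_z])
    then have Q0: "Q v = 0" using v card by (simp add: Q.zero)
    then have "refl_sum z v = 0" using v by (simp add: T_def)
    then have "v \<in> z" by (rule refl_sum_eq_0[OF z])
    then show "v = 0" using Q_on_z[of v] Q0 card by simp
  qed
  define S where "S = inv_into UNIV T"
  have ST: "S (T v) = v" for v unfolding S_def using \<open>inj T\<close> by simp
  have S_pres: "S v \<in> z'" if z': "z' \<in> carrier Lat" "z \<subseteq> z'" "v \<in> z'" for z' v
  proof -
    interpret ha: hyperplane_arrangement scale Basis UNIV arr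
      using finite_arr arr_hyperplane by unfold_locales auto
    have sub: "subspace z'" using z'(1) by (rule ha.carrier_subspace)
    have "Q u \<in> z'" for u using Q_z z'(2) by blast
    \<comment> \<open>An injective map of the finite-dimensional space \<open>z'\<close> into itself
      is onto, so the inverse of \<open>T\<close> preserves \<open>z'\<close> too.\<close>
    then have "T ` z' \<subseteq> z'"
      using refl_sum_preserves[OF z'(1,2)] subspace_add[OF sub] by (auto simp: T_def)
    moreover have "dim (T ` z') = dim z'"
      using \<open>inj T\<close> by (intro pair.dim_image_eq linT) (rule inj_on_subset[OF _ subset_UNIV])
    ultimately have "T ` z' = z'" by (intro subspace_dim_equal T.subspace_image sub) auto
    then show ?thesis using z'(3) ST by (metis imageE)
  qed
  show ?thesis
  proof (rule that)
    show linS: "Vector_Spaces.linear scale scale S"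
      unfolding S_def by (rule inj_linear_imp_inv_linear[OF linT \<open>inj T\<close>])
    show "S v \<in> z'" if "z' \<in> carrier Lat" "z \<subseteq> z'" "v \<in> z'" for z' v using S_pres that .
    fix v
    interpret S: Vector_Spaces.linear scale scale S by (rule linS)
    have "refl_sum z v = T v - Q v" by (simp add: T_def)
    then have "v - S (refl_sum z v) = S (Q v)" by (simp add: S.diff ST)
    then show "v - S (refl_sum z v) \<in> z" using S_pres[OF z order_refl Q_z] by simp
  qed
qed

end

section \<open>Restrictions of reflection arrangements\<close>

text \<open>The value 0 outside \<open>E\<close> matches the representation of functionals in
  \<open>dual_space\<close>.\<close>

definition transpose_on :: "'v set \<Rightarrow> ('v \<Rightarrow> 'v) \<Rightarrow> ('v \<Rightarrow> 'k::field) \<Rightarrow> 'v \<Rightarrow> 'k" where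
  "transpose_on E h \<phi> = (\<lambda>v. if v \<in> E then \<phi> (h v) else 0)"

lemma module_mult: "module ((*) :: 'k::field \<Rightarrow> 'k \<Rightarrow> 'k)"
  by unfold_locales (auto simp: algebra_simps)

lemma module_hom_transpose_on: "module_hom (fun_scale (*)) (fun_scale (*)) (transpose_on E h)"
  unfolding module_hom_def module_hom_axioms_def
  by (auto simp: module_fun_scale module_mult transpose_on_def fun_scale_def fun_eq_iff)

lemma subspace_dual_space: "module.subspace (fun_scale (*)) (dual_space scale E)"
proof -
  interpret module "fun_scale (*) :: 'k::field \<Rightarrow> ('v \<Rightarrow> 'k) \<Rightarrow> _"
    by (rule module_fun_scale[OF module_mult])
  show ?thesis by (auto simp: subspace_def dual_space_def fun_scale_def algebra_simps)
qed

lemma subspace_annihilator: "module.subspace (fun_scale (*)) (annihilator scale E H)"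
proof -
  interpret module "fun_scale (*) :: 'k::field \<Rightarrow> ('v \<Rightarrow> 'k) \<Rightarrow> _"
    by (rule module_fun_scale[OF module_mult])
  show ?thesis
    using subspace_dual_space[of scale E]
    by (auto simp: subspace_def annihilator_def fun_scale_def)
qed

lemma annihilator_subset: "annihilator scale E H \<subseteq> dual_space scale E"
  by (auto simp: annihilator_def)

context finite_linear_group
begin

lemma transpose_on_dual:
  assumes "Vector_Spaces.linear scale scale h" "subspace E" "\<And>v. v \<in> E \<Longrightarrow> h v \<in> E"
    "\<phi> \<in> dual_space scale E"
  shows "transpose_on E h \<phi> \<in> dual_space scale E"
proof -
  interpret h: Vector_Spaces.linear scale scale h by fact
  show ?thesis
    using assms(3,4) subspace_add[OF assms(2)] subspace_scale[OF assms(2)]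
    by (auto simp: dual_space_def transpose_on_def h.add h.scale)
qed

text \<open>A functional is additive on \<open>E\<close> only, so the induction keeps every partial
  sum inside \<open>E\<close>.\<close>

lemma dual_sum:
  assumes "subspace E" "\<phi> \<in> dual_space scale E" "\<And>i. i \<in> I \<Longrightarrow> h i \<in> E"
  shows "\<phi> (sum h I) = (\<Sum>i\<in>I. \<phi> (h i))"
proof -
  have "\<phi> (0 + 0) = \<phi> 0 + \<phi> 0"
    using assms(2) subspace_0[OF assms(1)] unfolding dual_space_def by blast
  then have zero: "\<phi> 0 = 0" by simp
  show ?thesis using assms(3)
  proof (induction I rule: infinite_finite_induct)
    case (insert i I)
    then have "h i \<in> E" "sum h I \<in> E" by (auto intro: subspace_sum[OF assms(1)])
    then have "\<phi> (h i + sum h I) = \<phi> (h i) + \<phi> (sum h I)"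
      using assms(2) unfolding dual_space_def by blast
    then show ?case using insert by simp
  qed (auto simp: zero)
qed

section \<open>The restricted arrangement and its relation complex\<close>

lemma restriction_arrangement:
  assumes "E \<in> carrier Lat"
  shows "hyperplane_arrangement scale Basis E (restriction arr E)"
proof -
  interpret ha: hyperplane_arrangement scale Basis UNIV arr
    using finite_arr arr_hyperplane by unfold_locales auto
  note sub = ha.carrier_subspace[OF assms]
  show ?thesis
  proof (unfold_locales, rule sub)
    have "restriction arr E \<subseteq> (\<lambda>H. H \<inter> E) ` arr" by (auto simp: restriction_def)
    then show "finite (restriction arr E)" using finite_arr finite_surj by blast
    fix H' assume "H' \<in> restriction arr E"
    then obtain H where H: "H \<in> arr" "\<not> E \<subseteq> H" "H' = E \<inter> H" by (auto simp: restriction_def)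
    then show "hyperplane_of scale E H'"
      using ha.hyperplane_Int[OF sub subset_UNIV H(1,2)] ha.carrier_subspace[OF ha.carrier_Int_hyperplane[OF assms H(1)]]
      by (auto simp: hyperplane_of_def)
  qed
qed

lemma carrier_restriction:
  assumes "E \<in> carrier Lat"
  shows "carrier (intersection_lattice E (restriction arr E)) = {y \<in> carrier Lat. y \<subseteq> E}"
  unfolding intersection_lattice_restriction[OF assms]
  by (simp add: upper_interval_def intersection_lattice_def)

text \<open>Reflections that fix \<open>E\<close> pointwise contribute 0 at \<open>v\<close>. The
  others are sorted by the intersection of their hyperplane with \<open>E\<close>.\<close>

lemma refl_sum_sum:
  assumes E: "E \<in> carrier Lat" and z: "z \<in> carrier Lat" "z \<subseteq> E" and v: "v \<in> E"
  shows "refl_sum z v = (\<Sum>a | a \<in> restriction arr E \<and> z \<subseteq> a. refl_sum a v)"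
proof -
  interpret he: hyperplane_arrangement scale Basis E "restriction arr E"
    by (rule restriction_arrangement[OF E])
  define R where "R a = refls a - refls E" for a
  let ?I = "{a. a \<in> restriction arr E \<and> z \<subseteq> a}"
  have refl_sum_R: "refl_sum a v = (\<Sum>g\<in>R a. v - g v)" for a
    unfolding refl_sum_def R_def using v finite_refls
    by (intro sum.mono_neutral_right) (auto simp: refls_def)
  \<comment> \<open>This recovers \<open>a\<close> from \<open>g\<close>, which makes the sets
    \<open>R a\<close> disjoint.\<close>
  have a_eq: "a = {u \<in> E. g u = u}" if a: "a \<in> restriction arr E" and g: "g \<in> R a" for a g
  proof -
    have gG: "g \<in> G" "\<exists>H. reflection_in scale H g" "\<And>u. u \<in> a \<Longrightarrow> g u = u" "g \<notin> refls E"
      using g by (auto simp: R_def refls_def)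
    have a': "subspace a" "a \<subseteq> E" "dim E = Suc (dim a)"
      using he.hyperplanes[OF a] by (auto simp: hyperplane_of_def)
    have sub: "subspace {u \<in> E. g u = u}"
      using subspace_inter[OF he.E subspace_fixed[OF gG(1)]] by (simp add: Int_def)
    have "\<not> dim E \<le> dim {u \<in> E. g u = u}"
    proof
      assume "dim E \<le> dim {u \<in> E. g u = u}"
      then have "{u \<in> E. g u = u} = E" by (intro subspace_dim_equal sub he.E) auto
      then have "g \<in> refls E" using gG(1,2) by (auto simp: refls_def)
      then show False using gG(4) by simp
    qed
    then show ?thesis using a' gG(3) by (intro subspace_dim_equal a'(1) sub) auto
  qed
  have union: "R z = (\<Union>a\<in>?I. R a)"
  proof (intro equalityI subsetI)
    fix g assume g: "g \<in> R z"
    then obtain H where H: "g \<in> G" "reflection_in scale H g" by (auto simp: R_def refls_def)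
    have fixed: "{u. g u = u} = H" using reflection_fixed[OF H] .
    have "H \<in> arr" using H by (auto simp: reflection_arrangement_def)
    moreover have "\<not> E \<subseteq> H" using g H fixed by (auto simp: R_def refls_def)
    ultimately have "H \<inter> E \<in> restriction arr E" by (auto simp: restriction_def)
    moreover have "z \<subseteq> H \<inter> E" using g z(2) fixed by (auto simp: R_def refls_def)
    moreover have "g \<in> R (H \<inter> E)" using g H fixed by (auto simp: R_def refls_def)
    ultimately show "g \<in> (\<Union>a\<in>?I. R a)" by blast
  next
    fix g assume "g \<in> (\<Union>a\<in>?I. R a)"
    then show "g \<in> R z" using refls_antimono[of z] by (auto simp: R_def)
  qed
  have "finite ?I" using he.finite_arr by simp
  moreover have "\<forall>a\<in>?I. finite (R a)" using finite_refls by (auto simp: R_def)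
  moreover have "\<forall>a\<in>?I. \<forall>a'\<in>?I. a \<noteq> a' \<longrightarrow> R a \<inter> R a' = {}"
    using a_eq by blast
  ultimately have "(\<Sum>g\<in>(\<Union>a\<in>?I. R a). v - g v) = (\<Sum>a\<in>?I. \<Sum>g\<in>R a. v - g v)"
    by (rule sum.UNION_disjoint)
  then show ?thesis unfolding refl_sum_R union .
qed

theorem contractible_restriction:
  assumes E: "E \<in> carrier Lat"
  shows "contractible_over (intersection_lattice E (restriction arr E))
    (relation_complex scale E (restriction arr E))"
proof -
  interpret he: hyperplane_arrangement scale Basis E "restriction arr E"
    by (rule restriction_arrangement[OF E])
  note car = carrier_restriction[OF E]
  have refl_sum_E: "refl_sum z v \<in> E" if "z \<subseteq> E" "v \<in> E" for z v using refl_sum_preserves[OF E that] .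
  \<comment> \<open>This identifies \<open>\<Delta>\<^sub>z\<close> as the transpose of
    \<open>refl_sum z\<close>. The order is reverse inclusion, so the atoms below \<open>z\<close>
    are the restricted hyperplanes containing \<open>z\<close>.\<close>
  have sum_transpose_on: "(\<Sum>a | a \<in> restriction arr E \<and> z \<subseteq> a. transpose_on E (refl_sum a) \<phi>) = transpose_on E (refl_sum z) \<phi>"
    if z: "z \<in> carrier he.L" and \<phi>: "\<phi> \<in> dual_space scale E" for z \<phi>
  proof
    fix v
    show "(\<Sum>a | a \<in> restriction arr E \<and> z \<subseteq> a. transpose_on E (refl_sum a) \<phi>) v = transpose_on E (refl_sum z) \<phi> v"
    proof (cases "v \<in> E")
      case True
      have "a \<subseteq> E" if "a \<in> restriction arr E" for a using that by (auto simp: restriction_def)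
      then have "(\<Sum>a | a \<in> restriction arr E \<and> z \<subseteq> a. \<phi> (refl_sum a v)) =
          \<phi> (\<Sum>a | a \<in> restriction arr E \<and> z \<subseteq> a. refl_sum a v)"
        by (intro dual_sum[OF he.E \<phi>, symmetric] refl_sum_E True) auto
      then show ?thesis
        using True z refl_sum_sum[OF E, of z v] by (simp add: sum_fun_apply transpose_on_def car)
    qed (simp add: sum_fun_apply transpose_on_def)
  qed
  note annih_dual = subsetD[OF annihilator_subset]
  have transpose_on_annih: "transpose_on E h \<phi> \<in> annihilator scale E a"
    if h: "Vector_Spaces.linear scale scale h" "\<And>v. v \<in> E \<Longrightarrow> h v \<in> E" "\<And>v. v \<in> a \<Longrightarrow> h v \<in> a"
      and \<phi>: "\<phi> \<in> annihilator scale E a" for h \<phi> a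
    using transpose_on_dual[OF h(1) he.E h(2) annih_dual[OF \<phi>]] h(3) \<phi>
    by (auto simp: annihilator_def transpose_on_def)
  interpret homotopy_datum "fun_scale (*)" he.L "dual_space scale E" "annihilator scale E" E
    "\<lambda>a. transpose_on E (refl_sum a)"
  proof (rule homotopy_datum.intro, unfold he.level_1 he.le_L)
    fix a assume a: "a \<in> restriction arr E"
    then have aE: "a \<subseteq> E" and aL: "a \<in> carrier Lat"
      using he.arr_carrier[OF a] by (auto simp: car)
    fix \<phi>
    show "transpose_on E (refl_sum a) \<phi> \<in> annihilator scale E a" if "\<phi> \<in> dual_space scale E"
    proof -
      \<comment> \<open>The operator \<open>refl_sum a\<close> sends \<open>a\<close> to 0, so the
        transposed functional vanishes on \<open>a\<close>.\<close>
      have "\<phi> 0 = 0" using dual_sum[OF he.E that, of "{}"] by simp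
      then show ?thesis
        using transpose_on_dual[OF linear_refl_sum he.E refl_sum_E[OF aE] that] by (auto simp: annihilator_def transpose_on_def refl_sum_zero)
    qed
    fix z
    assume z: "z \<in> carrier he.L" "z \<subseteq> a" and \<phi>: "\<phi> \<in> annihilator scale E a"
    show "(\<Sum>a' | a' \<in> restriction arr E \<and> z \<subseteq> a'. transpose_on E (refl_sum a') \<phi>) \<in> annihilator scale E a"
      unfolding sum_transpose_on[OF z(1) annih_dual[OF \<phi>]]
      using refl_sum_E[of z] refl_sum_preserves[OF aL z(2)] z(2) aE
      by (intro transpose_on_annih linear_refl_sum \<phi>) auto
  next
    fix t y y' z
    assume "covers he.L t y'" "y \<subseteq> t" "\<not> y \<subseteq> y'" "y \<in> carrier he.L" "z \<in> carrier he.L" "z \<subseteq> y" "z \<subseteq> y'"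
    then show "\<exists>!w. covers he.L y w \<and> z \<subseteq> w \<and> w \<subseteq> y'"
      using he.diamond_L[of t y' y z] unfolding he.le_L by blast
  qed (simp_all only: module_fun_scale module_mult he.partial_order_L he.finite_carrier he.graded_L
      he.level_0 he.carrier_subset subspace_dual_space
      subspace_annihilator module_hom_transpose_on annihilator_subset)
  show ?thesis unfolding relation_complex_def
  proof (rule contractible)
    fix z assume z: "z \<in> carrier he.L"
    then have zL: "z \<in> carrier Lat" "z \<subseteq> E" by (auto simp: car)
    obtain S where S: "Vector_Spaces.linear scale scale S"
      "\<And>z' v. z' \<in> carrier Lat \<Longrightarrow> z \<subseteq> z' \<Longrightarrow> v \<in> z' \<Longrightarrow> S v \<in> z'"
      "\<And>v. v - S (refl_sum z v) \<in> z"
      by (rule refl_sum_inverse[OF zL(1)]) blast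
    have S_E: "S v \<in> E" if "v \<in> E" for v using S(2)[OF E zL(2) that] .
    show "\<exists>A. module_hom (fun_scale (*)) (fun_scale (*)) A \<and>
        (\<forall>a\<in>level he.L 1. a \<sqsubseteq>\<^bsub>he.L\<^esub> z \<longrightarrow>
          (\<forall>u\<in>annihilator scale E a. A u \<in> annihilator scale E a \<and> laplacian z (A u) = u))"
    \<comment> \<open>Transposition reverses composition: a left inverse of
      \<open>refl_sum z\<close> modulo \<open>z\<close> becomes a right inverse of
      \<open>\<Delta>\<^sub>z\<close> on functionals vanishing on \<open>z\<close>.\<close>
    proof (intro exI[of _ "transpose_on E S"] conjI ballI impI module_hom_transpose_on)
      fix a \<phi>
      assume a: "a \<in> level he.L 1" "a \<sqsubseteq>\<^bsub>he.L\<^esub> z" and \<phi>: "\<phi> \<in> annihilator scale E a"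
      have aL: "a \<in> carrier Lat" "z \<subseteq> a" "a \<subseteq> E"
        using a he.arr_carrier[of a] unfolding he.level_1 by (auto simp: car)
      show SA: "transpose_on E S \<phi> \<in> annihilator scale E a"
        using S_E S(2)[OF aL(1,2)] by (intro transpose_on_annih S(1) \<phi>) auto
      have "laplacian z (transpose_on E S \<phi>) = transpose_on E (refl_sum z) (transpose_on E S \<phi>)"
        unfolding laplacian_def he.level_1 he.le_L by (rule sum_transpose_on[OF z annih_dual[OF SA]])
      also have "\<dots> = \<phi>"
      proof
        fix v show "transpose_on E (refl_sum z) (transpose_on E S \<phi>) v = \<phi> v"
        proof (cases "v \<in> E")
          case True
          let ?w = "S (refl_sum z v)"
          \<comment> \<open>The difference \<open>v - ?w\<close> lies in \<open>z\<close>, hence in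
            \<open>a\<close>, where \<open>\<phi>\<close> vanishes.\<close>
          have w: "?w \<in> E" "v - ?w \<in> E" "\<phi> (v - ?w) = 0"
            using S_E refl_sum_E[OF zL(2) True] S(3)[of v] zL(2) aL \<phi> by (auto simp: annihilator_def)
          have "\<phi> ((v - ?w) + ?w) = \<phi> (v - ?w) + \<phi> ?w"
            using annih_dual[OF \<phi>] w unfolding dual_space_def by blast
          then show ?thesis using True w refl_sum_E[OF zL(2) True] by (simp add: transpose_on_def)
        next
          case False
          then show ?thesis using annih_dual[OF \<phi>] by (simp add: transpose_on_def dual_space_def)
        qed
      qed
      finally show "laplacian z (transpose_on E S \<phi>) = \<phi>" .
    qed
  qed
qed

end

theorem theorem4p10:
  fixes scale :: "complex \<Rightarrow> 'v::ab_group_add \<Rightarrow> 'v"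
    and Basis :: "'v set"
    and G :: "('v \<Rightarrow> 'v) set"
    and x :: "'v set"
  assumes "finite_dimensional_vector_space scale Basis"
    and "finite_reflection_group scale G"
    and "x \<in> carrier (intersection_lattice UNIV (reflection_arrangement scale G))"
  shows "contractible_over
           (intersection_lattice x (restriction (reflection_arrangement scale G) x))
           (relation_complex scale x (restriction (reflection_arrangement scale G) x))"
proof -
  interpret finite_dimensional_vector_space scale Basis by fact
  interpret finite_linear_group scale Basis G
    using assms(2)
    by (intro finite_linear_group.intro assms(1) finite_linear_group_axioms.intro)
      (simp_all add: finite_reflection_group_def)
  show ?thesis using assms(3) by (rule contractible_restriction)
qed

end
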